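(* Let $k$ be a commutative ring, $G$ a finite group and $\mathcal{C}$ a $G$-category over $k$ with a finite number of objects. Let $a(\mathcal{C})=\bigoplus_{x,y\in\mathcal{C}_0}{}_y\mathcal{C}_x$ be the $k$-algebra associated to $\mathcal{C}$, with the matrix product induced by composition of morphisms. Then $G$ acts on $a(\mathcal{C})$ by algebra automorphisms (the action being induced by the maps $s:{}_y\mathcal{C}_x\to{}_{sy}\mathcal{C}_{sx}$), and the algebra $a(\mathcal{C}[G])$ associated to the skew category $\mathcal{C}[G]$ is isomorphic as a $k$-algebra to the skew group algebra $a(\mathcal{C})[G]$.
   Context: Category over $k$: a small category $\mathcal{C}$ with object set $\mathcal{C}_0$ such that each morphism set ${}_y\mathcal{C}_x$ (morphisms from $x$ to $y$) is a $k$-module and composition is $k$-bilinear. $G$-category over $k$: a category $\mathcal{C}$ over $k$ with an action of $G$ on the set $\mathcal{C}_0$ and $k$-module maps $s:{}_y\mathcal{C}_x\to{}_{sy}\mathcal{C}_{sx}$ for all $s\in G$ and objects $x,y$, such that $s(gf)=(sg)(sf)$ for composable $g,f$, $(ts)f=t(sf)$ and $1f=f$. For a category $\mathcal{B}$ over $k$ with finitely many objects, $a(\mathcal{B})=\bigoplus_{x,y\in\mathcal{B}_0}{}_y\mathcal{B}_x$, with product of $g\in{}_z\mathcal{B}_{y'}$ and $f\in{}_y\mathcal{B}_x$ equal to $gf$ if $y=y'$ and $0$ otherwise. Skew category $\mathcal{C}[G]$: objects $\mathcal{C}_0$, morphisms ${}_y(\mathcal{C}[G])_x=\bigoplus_{s\in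 G}{}_y\mathcal{C}_{sx}$ (external direct sum indexed by $s$). For $g$ in the component ${}_z\mathcal{C}_{ty}$ indexed by $t$ and $f$ in the component ${}_y\mathcal{C}_{sx}$ indexed by $s$, the composite is $gf=g\circ(tf)$, in the component ${}_z\mathcal{C}_{tsx}$ indexed by $ts$. Skew group algebra: if $G$ acts on a $k$-algebra $A$ by automorphisms, $A[G]$ is the $k$-module $A\otimes_k kG$ with product determined by $(a\otimes t)(b\otimes s)=a\,t(b)\otimes ts$. *)

theory Defs
  imports "HOL-Algebra.Algebra" "HOL-Library.Poly_Mapping"
begin

section \<open>Modules and algebras over a commutative ring\<close>

definition linear_map ::
  "('k, 'r) ring_scheme \<Rightarrow> ('k, 'm, 'x) module_scheme \<Rightarrow> ('k, 'n, 'y) module_scheme \<Rightarrow> ('m \<Rightarrow> 'n) \<Rightarrow> bool"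
  where "linear_map k M N h \<longleftrightarrow>
    h \<in> carrier M \<rightarrow> carrier N \<and>
    (\<forall>x \<in> carrier M. \<forall>y \<in> carrier M. h (x \<oplus>\<^bsub>M\<^esub> y) = h x \<oplus>\<^bsub>N\<^esub> h y) \<and>
    (\<forall>a \<in> carrier k. \<forall>x \<in> carrier M. h (a \<odot>\<^bsub>M\<^esub> x) = a \<odot>\<^bsub>N\<^esub> h x)"

definition bilinear_map ::
  "('k, 'r) ring_scheme \<Rightarrow> ('k, 'm, 'x) module_scheme \<Rightarrow> ('k, 'n, 'y) module_scheme \<Rightarrow>
   ('k, 'p, 'z) module_scheme \<Rightarrow> ('m \<Rightarrow> 'n \<Rightarrow> 'p) \<Rightarrow> bool"
  where "bilinear_map k M N P b \<longleftrightarrow>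
    (\<forall>x \<in> carrier M. linear_map k N P (b x)) \<and>
    (\<forall>y \<in> carrier N. linear_map k M P (\<lambda>x. b x y))"

text \<open>The library locale \<^locale>\<open>algebra\<close> requires a commutative product, so it cannot be used here.\<close>

locale associative_algebra = module + ring M +
  assumes smult_mult_left:
      "\<lbrakk>a \<in> carrier R; x \<in> carrier M; y \<in> carrier M\<rbrakk> \<Longrightarrow>
       (a \<odot>\<^bsub>M\<^esub> x) \<otimes>\<^bsub>M\<^esub> y = a \<odot>\<^bsub>M\<^esub> (x \<otimes>\<^bsub>M\<^esub> y)"
    and smult_mult_right:
      "\<lbrakk>a \<in> carrier R; x \<in> carrier M; y \<in> carrier M\<rbrakk> \<Longrightarrow>
       x \<otimes>\<^bsub>M\<^esub> (a \<odot>\<^bsub>M\<^esub> y) = a \<odot>\<^bsub>M\<^esub> (x \<otimes>\<^bsub>M\<^esub> y)"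

definition algebra_iso ::
  "('k, 'r) ring_scheme \<Rightarrow> ('k, 'm, 'x) module_scheme \<Rightarrow> ('k, 'n, 'y) module_scheme \<Rightarrow> ('m \<Rightarrow> 'n) set"
  where "algebra_iso k A B = {h \<in> ring_iso A B. linear_map k A B h}"

definition algebra_isomorphic ::
  "('k, 'r) ring_scheme \<Rightarrow> ('k, 'm, 'x) module_scheme \<Rightarrow> ('k, 'n, 'y) module_scheme \<Rightarrow> bool"
  where "algebra_isomorphic k A B \<longleftrightarrow>
    associative_algebra k A \<and> associative_algebra k B \<and> algebra_iso k A B \<noteq> {}"

definition acts_by_algebra_automorphisms ::
  "('k, 'r) ring_scheme \<Rightarrow> ('g, 'h) monoid_scheme \<Rightarrow> ('k, 'm, 'x) module_scheme \<Rightarrow> ('g \<Rightarrow> 'm \<Rightarrow> 'm) \<Rightarrow> bool"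
  where "acts_by_algebra_automorphisms k G A \<alpha> \<longleftrightarrow>
    associative_algebra k A \<and> group_action G (carrier A) \<alpha> \<and>
    (\<forall>s \<in> carrier G. \<alpha> s \<in> algebra_iso k A A)"

text \<open>Modules are records of type \<^typ>\<open>('k, 'm) module\<close>, which also have the fields \<^const>\<open>monoid.mult\<close>
  and \<^const>\<open>one\<close>; these carry no meaning, and are left undefined, where only a module is built.\<close>

definition direct_sum :: "'i set \<Rightarrow> ('i \<Rightarrow> ('k, 'm, 'x) module_scheme) \<Rightarrow> ('k, 'i \<Rightarrow> 'm) module"
  where "direct_sum I M =
    \<lparr>carrier = {f \<in> (\<Pi>\<^sub>E i\<in>I. carrier (M i)). finite {i \<in> I. f i \<noteq> \<zero>\<^bsub>M i\<^esub>}},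
     monoid.mult = undefined,
     one = undefined,
     ring.zero = (\<lambda>i\<in>I. \<zero>\<^bsub>M i\<^esub>),
     ring.add = (\<lambda>f g. \<lambda>i\<in>I. f i \<oplus>\<^bsub>M i\<^esub> g i),
     module.smult = (\<lambda>a f. \<lambda>i\<in>I. a \<odot>\<^bsub>M i\<^esub> f i)\<rparr>"

definition regular_module :: "('k, 'r) ring_scheme \<Rightarrow> ('k, 'k) module"
  where "regular_module k =
    \<lparr>carrier = carrier k, monoid.mult = monoid.mult k, one = one k, ring.zero = ring.zero k, ring.add = ring.add k,
     module.smult = monoid.mult k\<rparr>"

text \<open>The tensor product of \<open>M\<close> and \<open>N\<close> over \<open>k\<close> is the free abelian group on
  \<open>carrier M \<times> carrier N\<close> modulo the subgroup generated by the usual relations, so its elements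
  are cosets.\<close>

definition tensor_relations ::
  "('k, 'r) ring_scheme \<Rightarrow> ('k, 'm, 'x) module_scheme \<Rightarrow> ('k, 'n, 'y) module_scheme \<Rightarrow> ('m \<times> 'n \<Rightarrow>\<^sub>0 int) set"
  where "tensor_relations k M N =
    {frag_of (m \<oplus>\<^bsub>M\<^esub> m', n) - frag_of (m, n) - frag_of (m', n) | m m' n.
       m \<in> carrier M \<and> m' \<in> carrier M \<and> n \<in> carrier N} \<union>
    {frag_of (m, n \<oplus>\<^bsub>N\<^esub> n') - frag_of (m, n) - frag_of (m, n') | m n n'.
       m \<in> carrier M \<and> n \<in> carrier N \<and> n' \<in> carrier N} \<union>
    {frag_of (a \<odot>\<^bsub>M\<^esub> m, n) - frag_of (m, a \<odot>\<^bsub>N\<^esub> n) | a m n.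
       a \<in> carrier k \<and> m \<in> carrier M \<and> n \<in> carrier N}"

definition tensor_kernel ::
  "('k, 'r) ring_scheme \<Rightarrow> ('k, 'm, 'x) module_scheme \<Rightarrow> ('k, 'n, 'y) module_scheme \<Rightarrow> ('m \<times> 'n \<Rightarrow>\<^sub>0 int) set"
  where "tensor_kernel k M N =
    generate (free_Abelian_group (carrier M \<times> carrier N)) (tensor_relations k M N)"

definition tensor_class ::
  "('k, 'r) ring_scheme \<Rightarrow> ('k, 'm, 'x) module_scheme \<Rightarrow> ('k, 'n, 'y) module_scheme \<Rightarrow>
   ('m \<times> 'n \<Rightarrow>\<^sub>0 int) \<Rightarrow> ('m \<times> 'n \<Rightarrow>\<^sub>0 int) set"
  where "tensor_class k M N c =
    tensor_kernel k M N #>\<^bsub>free_Abelian_group (carrier M \<times> carrier N)\<^esub> c"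

definition pure_tensor ::
  "('k, 'r) ring_scheme \<Rightarrow> ('k, 'm, 'x) module_scheme \<Rightarrow> ('k, 'n, 'y) module_scheme \<Rightarrow>
   'm \<Rightarrow> 'n \<Rightarrow> ('m \<times> 'n \<Rightarrow>\<^sub>0 int) set"
  where "pure_tensor k M N m n = tensor_class k M N (frag_of (m, n))"

text \<open>In the scalar multiplication, every representative \<open>c\<close> of the coset \<open>S\<close> gives the same
  coset, so that the union is that coset.\<close>

definition tensor_product ::
  "('k, 'r) ring_scheme \<Rightarrow> ('k, 'm, 'x) module_scheme \<Rightarrow> ('k, 'n, 'y) module_scheme \<Rightarrow>
   ('k, ('m \<times> 'n \<Rightarrow>\<^sub>0 int) set) module"
  where "tensor_product k M N =
    (let Q = free_Abelian_group (carrier M \<times> carrier N) Mod tensor_kernel k M N in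
     \<lparr>carrier = carrier Q,
      monoid.mult = undefined,
      one = undefined,
      ring.zero = one Q,
      ring.add = monoid.mult Q,
      module.smult = (\<lambda>a S. \<Union>c\<in>S. tensor_class k M N (frag_extend (\<lambda>(m, n). frag_of (a \<odot>\<^bsub>M\<^esub> m, n)) c))\<rparr>)"


section \<open>Categories over a commutative ring\<close>

text \<open>\<open>Mor C y x\<close> is the module of morphisms from \<open>x\<close> to \<open>y\<close>, and \<open>Cmp C z y x g f\<close> is the composite
  of \<open>f\<close> from \<open>x\<close> to \<open>y\<close> with \<open>g\<close> from \<open>y\<close> to \<open>z\<close>. Morphism modules for different
  pairs of objects share a type but need not be disjoint, so operations on morphisms
  take the objects as arguments.\<close>

record ('o, 'k, 'm) lincat =
  Ob :: "'o set"
  Mor :: "'o \<Rightarrow> 'o \<Rightarrow> ('k, 'm) module"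
  Cmp :: "'o \<Rightarrow> 'o \<Rightarrow> 'o \<Rightarrow> 'm \<Rightarrow> 'm \<Rightarrow> 'm"
  Idt :: "'o \<Rightarrow> 'm"

locale category_over = cring k for k :: "('k, 'r) ring_scheme" (structure) and C :: "('o, 'k, 'm, 'c) lincat_scheme" +
  assumes Mor_module: "\<lbrakk>x \<in> Ob C; y \<in> Ob C\<rbrakk> \<Longrightarrow> module k (Mor C y x)"
    and Cmp_bilinear: "\<lbrakk>x \<in> Ob C; y \<in> Ob C; z \<in> Ob C\<rbrakk> \<Longrightarrow>
      bilinear_map k (Mor C z y) (Mor C y x) (Mor C z x) (Cmp C z y x)"
    and Cmp_assoc: "\<lbrakk>w \<in> Ob C; x \<in> Ob C; y \<in> Ob C; z \<in> Ob C;
        h \<in> carrier (Mor C z y); g \<in> carrier (Mor C y x); f \<in> carrier (Mor C x w)\<rbrakk> \<Longrightarrow>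
      Cmp C z x w (Cmp C z y x h g) f = Cmp C z y w h (Cmp C y x w g f)"
    and Idt_closed: "x \<in> Ob C \<Longrightarrow> Idt C x \<in> carrier (Mor C x x)"
    and Idt_left: "\<lbrakk>x \<in> Ob C; y \<in> Ob C; f \<in> carrier (Mor C y x)\<rbrakk> \<Longrightarrow> Cmp C y y x (Idt C y) f = f"
    and Idt_right: "\<lbrakk>x \<in> Ob C; y \<in> Ob C; f \<in> carrier (Mor C y x)\<rbrakk> \<Longrightarrow> Cmp C y x x f (Idt C x) = f"

text \<open>\<open>act_mor C s y x\<close> is the map \<open>s\<close> from \<open>Mor C y x\<close> to \<open>Mor C (s y) (s x)\<close>.\<close>

record ('o, 'k, 'm, 'g) gcat = "('o, 'k, 'm) lincat" +
  act_ob :: "'g \<Rightarrow> 'o \<Rightarrow> 'o"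
  act_mor :: "'g \<Rightarrow> 'o \<Rightarrow> 'o \<Rightarrow> 'm \<Rightarrow> 'm"

locale G_category = category_over k C + group_action G "Ob C" "act_ob C"
  for k :: "('k, 'r) ring_scheme" (structure) and G :: "('g, 'h) monoid_scheme" (structure)
    and C :: "('o, 'k, 'm, 'g, 'c) gcat_scheme" +
  assumes act_mor_linear: "\<lbrakk>s \<in> carrier G; x \<in> Ob C; y \<in> Ob C\<rbrakk> \<Longrightarrow>
      linear_map k (Mor C y x) (Mor C (act_ob C s y) (act_ob C s x)) (act_mor C s y x)"
    and act_mor_Cmp: "\<lbrakk>s \<in> carrier G; x \<in> Ob C; y \<in> Ob C; z \<in> Ob C;
        g \<in> carrier (Mor C z y); f \<in> carrier (Mor C y x)\<rbrakk> \<Longrightarrow>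
      act_mor C s z x (Cmp C z y x g f) =
        Cmp C (act_ob C s z) (act_ob C s y) (act_ob C s x) (act_mor C s z y g) (act_mor C s y x f)"
    and act_mor_mult: "\<lbrakk>t \<in> carrier G; s \<in> carrier G; x \<in> Ob C; y \<in> Ob C; f \<in> carrier (Mor C y x)\<rbrakk> \<Longrightarrow>
      act_mor C (t \<otimes>\<^bsub>G\<^esub> s) y x f = act_mor C t (act_ob C s y) (act_ob C s x) (act_mor C s y x f)"
    and act_mor_one: "\<lbrakk>x \<in> Ob C; y \<in> Ob C; f \<in> carrier (Mor C y x)\<rbrakk> \<Longrightarrow>
      act_mor C \<one>\<^bsub>G\<^esub> y x f = f"

text \<open>The algebra \<open>a(C)\<close> of a category with finitely many objects: the entry of \<open>f\<close> in
  \<open>Mor C y x\<close> is \<open>f (y, x)\<close>.\<close>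

definition category_algebra :: "('o, 'k, 'm, 'c) lincat_scheme \<Rightarrow> ('k, 'o \<times> 'o \<Rightarrow> 'm) module"
  where "category_algebra C =
    (direct_sum (Ob C \<times> Ob C) (\<lambda>(y, x). Mor C y x))
      \<lparr>monoid.mult := (\<lambda>g f. \<lambda>(z, x)\<in>Ob C \<times> Ob C. \<Oplus>\<^bsub>Mor C z x\<^esub>y\<in>Ob C. Cmp C z y x (g (z, y)) (f (y, x))),
       one := (\<lambda>(y, x)\<in>Ob C \<times> Ob C. if y = x then Idt C x else \<zero>\<^bsub>Mor C y x\<^esub>)\<rparr>"

text \<open>The action of \<open>s\<close> on \<open>a(C)\<close> maps the \<open>(y, x)\<close> entry to the \<open>(s y, s x)\<close> entry; hence the inverses.\<close>

definition category_algebra_action ::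
  "('g, 'h) monoid_scheme \<Rightarrow> ('o, 'k, 'm, 'g, 'c) gcat_scheme \<Rightarrow> 'g \<Rightarrow> ('o \<times> 'o \<Rightarrow> 'm) \<Rightarrow> ('o \<times> 'o \<Rightarrow> 'm)"
  where "category_algebra_action G C s =
    (\<lambda>f\<in>carrier (category_algebra C). \<lambda>(y, x)\<in>Ob C \<times> Ob C.
       let y' = act_ob C (inv\<^bsub>G\<^esub> s) y; x' = act_ob C (inv\<^bsub>G\<^esub> s) x in act_mor C s y' x' (f (y', x')))"

text \<open>The entry of a morphism \<open>f\<close> of \<open>C[G]\<close> in the summand indexed by \<open>s\<close> is \<open>f s\<close>. The sum in the
  composite is restricted to the nonzero entries so that it is finite for an arbitrary group.\<close>

definition skew_category ::
  "('g, 'h) monoid_scheme \<Rightarrow> ('o, 'k, 'm, 'g, 'c) gcat_scheme \<Rightarrow> ('o, 'k, 'g \<Rightarrow> 'm) lincat"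
  where "skew_category G C =
    \<lparr>Ob = Ob C,
     Mor = (\<lambda>y x. direct_sum (carrier G) (\<lambda>s. Mor C y (act_ob C s x))),
     Cmp = (\<lambda>z y x g f. \<lambda>u\<in>carrier G.
       finsum (Mor C z (act_ob C u x))
         (\<lambda>(t, s). Cmp C z (act_ob C t y) (act_ob C u x) (g t) (act_mor C t y (act_ob C s x) (f s)))
         {(t, s). t \<in> carrier G \<and> s \<in> carrier G \<and> t \<otimes>\<^bsub>G\<^esub> s = u \<and>
            g t \<noteq> \<zero>\<^bsub>Mor C z (act_ob C t y)\<^esub> \<and> f s \<noteq> \<zero>\<^bsub>Mor C y (act_ob C s x)\<^esub>}),
     Idt = (\<lambda>x. \<lambda>s\<in>carrier G. if s = \<one>\<^bsub>G\<^esub> then Idt C x else \<zero>\<^bsub>Mor C x (act_ob C s x)\<^esub>)\<rparr>"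


section \<open>Skew group algebras\<close>

definition group_module :: "('k, 'r) ring_scheme \<Rightarrow> ('g, 'h) monoid_scheme \<Rightarrow> ('k, 'g \<Rightarrow> 'k) module"
  where "group_module k G = direct_sum (carrier G) (\<lambda>_. regular_module k)"

definition group_basis :: "('k, 'r) ring_scheme \<Rightarrow> ('g, 'h) monoid_scheme \<Rightarrow> 'g \<Rightarrow> 'g \<Rightarrow> 'k"
  where "group_basis k G t = (\<lambda>s\<in>carrier G. if s = t then \<one>\<^bsub>k\<^esub> else \<zero>\<^bsub>k\<^esub>)"

definition skew_tensor ::
  "('k, 'r) ring_scheme \<Rightarrow> ('g, 'h) monoid_scheme \<Rightarrow> ('k, 'a, 'x) module_scheme \<Rightarrow> 'a \<Rightarrow> 'g \<Rightarrow>
   ('a \<times> ('g \<Rightarrow> 'k) \<Rightarrow>\<^sub>0 int) set"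
  where "skew_tensor k G A a t = pure_tensor k A (group_module k G) a (group_basis k G t)"

text \<open>The elements \<open>a \<otimes> t\<close> generate \<open>A \<otimes> kG\<close>, so the two conditions determine the product on the
  carrier; outside of it, the product is irrelevant.\<close>

definition skew_mult ::
  "('k, 'r) ring_scheme \<Rightarrow> ('g, 'h) monoid_scheme \<Rightarrow> ('k, 'a, 'x) module_scheme \<Rightarrow> ('g \<Rightarrow> 'a \<Rightarrow> 'a) \<Rightarrow>
   ('a \<times> ('g \<Rightarrow> 'k) \<Rightarrow>\<^sub>0 int) set \<Rightarrow> ('a \<times> ('g \<Rightarrow> 'k) \<Rightarrow>\<^sub>0 int) set \<Rightarrow> ('a \<times> ('g \<Rightarrow> 'k) \<Rightarrow>\<^sub>0 int) set"
  where "skew_mult k G A \<alpha> =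
    (SOME \<mu>. let T = tensor_product k A (group_module k G) in
       bilinear_map k T T T \<mu> \<and>
       (\<forall>a \<in> carrier A. \<forall>b \<in> carrier A. \<forall>t \<in> carrier G. \<forall>s \<in> carrier G.
          \<mu> (skew_tensor k G A a t) (skew_tensor k G A b s) =
            skew_tensor k G A (a \<otimes>\<^bsub>A\<^esub> \<alpha> t b) (t \<otimes>\<^bsub>G\<^esub> s)))"

definition skew_group_algebra ::
  "('k, 'r) ring_scheme \<Rightarrow> ('g, 'h) monoid_scheme \<Rightarrow> ('k, 'a, 'x) module_scheme \<Rightarrow> ('g \<Rightarrow> 'a \<Rightarrow> 'a) \<Rightarrow>
   ('k, ('a \<times> ('g \<Rightarrow> 'k) \<Rightarrow>\<^sub>0 int) set) module"
  where "skew_group_algebra k G A \<alpha> =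
    (tensor_product k A (group_module k G))
      \<lparr>monoid.mult := skew_mult k G A \<alpha>,
       one := skew_tensor k G A \<one>\<^bsub>A\<^esub> \<one>\<^bsub>G\<^esub>\<rparr>"

end

theory Submission
  imports Defs
begin

text \<open>Choosing the group elements as basis identifies \<open>A \<otimes> kG\<close> with the functions \<open>G \<Rightarrow> A\<close>, on which the
  product of the skew group algebra becomes the twisted convolution
  \<open>(f g)(u) = \<Sum>t. f t \<cdot> t (g (t\<inverse> u))\<close>. For \<open>A = a(C)\<close>, such a function \<open>f\<close> corresponds to the element
  of \<open>a(C[G])\<close> whose \<open>(y, x)\<close> entry has the component \<open>f s (y, s x)\<close> at \<open>s\<close>. Composition in \<open>C[G]\<close> turns
  into the twisted convolution after the substitution \<open>y \<mapsto> t y\<close> in the sum over intermediate objects.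
  Both comparison maps are bijective and respect the operations, so the algebra axioms are transported
  along them from the convolution algebra.\<close>

section \<open>Finite sums, linear maps and algebras\<close>

text \<open>The product of the skew group algebra is chosen by \<open>SOME\<close>, so two things
  must be shown: a bilinear product with the prescribed values on the elements
  \<open>a \<otimes> t\<close> exists, and whichever one is chosen agrees with convolution.
  Existence is obtained by carrying convolution over to the tensor product; agreement follows from
  bilinearity, because the functions supported at one point span. Elements of the tensor product are
  cosets in a free abelian group, so maps out of it require the universal property. The comparison
  map therefore runs from functions to tensors, where it is an explicit sum, and only its inverse is
  obtained from the universal property. The position \<open>(y, s x)\<close> is dictated by the skew
  category: the summand at \<open>s\<close> of the morphisms from \<open>x\<close> to
  \<open>y\<close> is \<open>Mor C y (s x)\<close>. Likewise, composing a component at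
  \<open>t\<close> with one translated by \<open>t\<close> passes through the object
  \<open>t y\<close>, whereas the matrix product runs over all objects; for fixed \<open>t\<close>
  the two sums agree because \<open>t\<close> permutes the objects.\<close>

lemma (in abelian_monoid) finsum_swap:
  assumes "finite A" "finite B" "\<And>a b. \<lbrakk>a \<in> A; b \<in> B\<rbrakk> \<Longrightarrow> f a b \<in> carrier G"
  shows "(\<Oplus>a\<in>A. \<Oplus>b\<in>B. f a b) = (\<Oplus>b\<in>B. \<Oplus>a\<in>A. f a b)"
  using assms(1,3)
proof (induction A rule: finite_induct)
  case empty
  then show ?case by (simp add: finsum_zero)
next
  case (insert a A)
  have "(\<Oplus>a\<in>insert a A. \<Oplus>b\<in>B. f a b) = (\<Oplus>b\<in>B. f a b) \<oplus> (\<Oplus>b\<in>B. \<Oplus>a\<in>A. f a b)"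
    using insert by (subst finsum_insert) (auto intro!: finsum_closed)
  also have "\<dots> = (\<Oplus>b\<in>B. f a b \<oplus> (\<Oplus>a\<in>A. f a b))"
    using insert by (subst finsum_addf) (auto intro!: finsum_closed)
  also have "\<dots> = (\<Oplus>b\<in>B. \<Oplus>a\<in>insert a A. f a b)"
    using insert by (intro finsum_cong') (auto intro!: finsum_closed add.m_closed)
  finally show ?case .
qed

lemma (in abelian_monoid) finsum_bij_betw:
  assumes "bij_betw h A B" "f \<in> B \<rightarrow> carrier G"
  shows "(\<Oplus>b\<in>B. f b) = (\<Oplus>a\<in>A. f (h a))"
  using assms by (auto simp: bij_betw_def intro: finsum_reindex)

lemma (in abelian_monoid) finsum_delta:
  assumes "finite A" "i \<in> A" "a \<in> carrier G" "\<And>j. \<lbrakk>j \<in> A; j \<noteq> i\<rbrakk> \<Longrightarrow> f j = \<zero>" "f i = a"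
  shows "(\<Oplus>j\<in>A. f j) = a"
proof -
  have "(\<Oplus>j\<in>A. f j) = (\<Oplus>j\<in>A. if i = j then a else \<zero>)"
    using assms by (intro finsum_cong') auto
  also have "\<dots> = a"
    using assms finsum_singleton[of i A "\<lambda>_. a"] by simp
  finally show ?thesis .
qed

subsection \<open>Linear and bilinear maps\<close>

lemma linear_mapI:
  assumes "\<And>x. x \<in> carrier M \<Longrightarrow> h x \<in> carrier N"
    and "\<And>x y. \<lbrakk>x \<in> carrier M; y \<in> carrier M\<rbrakk> \<Longrightarrow> h (x \<oplus>\<^bsub>M\<^esub> y) = h x \<oplus>\<^bsub>N\<^esub> h y"
    and "\<And>a x. \<lbrakk>a \<in> carrier k; x \<in> carrier M\<rbrakk> \<Longrightarrow> h (a \<odot>\<^bsub>M\<^esub> x) = a \<odot>\<^bsub>N\<^esub> h x"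
  shows "linear_map k M N h"
  using assms by (auto simp: linear_map_def)

lemma linear_mapD:
  assumes "linear_map k M N h"
  shows linear_map_closed: "x \<in> carrier M \<Longrightarrow> h x \<in> carrier N"
    and linear_map_add: "\<lbrakk>x \<in> carrier M; y \<in> carrier M\<rbrakk> \<Longrightarrow> h (x \<oplus>\<^bsub>M\<^esub> y) = h x \<oplus>\<^bsub>N\<^esub> h y"
    and linear_map_smult: "\<lbrakk>a \<in> carrier k; x \<in> carrier M\<rbrakk> \<Longrightarrow> h (a \<odot>\<^bsub>M\<^esub> x) = a \<odot>\<^bsub>N\<^esub> h x"
  using assms by (auto simp: linear_map_def)

lemma linear_map_zero:
  assumes "linear_map k M N h" "abelian_group M" "abelian_group N"
  shows "h \<zero>\<^bsub>M\<^esub> = \<zero>\<^bsub>N\<^esub>"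
proof -
  interpret M: abelian_group M by fact
  interpret N: abelian_group N by fact
  have "h \<zero>\<^bsub>M\<^esub> \<oplus>\<^bsub>N\<^esub> h \<zero>\<^bsub>M\<^esub> = h \<zero>\<^bsub>M\<^esub>"
    using linear_map_add[OF assms(1) M.zero_closed M.zero_closed] by simp
  then show ?thesis
    using linear_map_closed[OF assms(1) M.zero_closed] N.add.r_cancel_one by blast
qed

lemma linear_map_finsum:
  assumes "linear_map k M N h" "abelian_group M" "abelian_group N" "f \<in> A \<rightarrow> carrier M"
  shows "h (finsum M f A) = finsum N (\<lambda>i. h (f i)) A"
proof -
  interpret M: abelian_group M by fact
  interpret N: abelian_group N by fact
  show ?thesis
    using assms(4)
  proof (induction A rule: infinite_finite_induct)
    case (insert a A)
    then have "f a \<in> carrier M" "f \<in> A \<rightarrow> carrier M" by auto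
    with insert show ?case
      using linear_map_closed[OF assms(1)]
      by (simp add: linear_map_add[OF assms(1)] Pi_iff)
  qed (simp_all add: linear_map_zero[OF assms(1-3)])
qed

lemma linear_map_comp:
  assumes "linear_map k M N f" "linear_map k N P g"
  shows "linear_map k M P (\<lambda>x. g (f x))"
  using assms by (intro linear_mapI) (auto simp: linear_mapD)

lemma bilinear_mapD:
  assumes "bilinear_map k M N P b"
  shows bilinear_map_right: "x \<in> carrier M \<Longrightarrow> linear_map k N P (b x)"
    and bilinear_map_left: "y \<in> carrier N \<Longrightarrow> linear_map k M P (\<lambda>x. b x y)"
  using assms by (auto simp: bilinear_map_def)

lemma bilinear_map_closed:
  assumes "bilinear_map k M N P b" "x \<in> carrier M" "y \<in> carrier N"
  shows "b x y \<in> carrier P"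
  using assms bilinear_map_right linear_map_closed by metis

subsection \<open>Associative algebras\<close>

text \<open>Bilinearity of the product bundles both distributive laws with both scalar laws, so
  every algebra below is delivered as a module with a bilinear, associative, unital product.\<close>

lemma associative_algebraI:
  assumes "module k A" "bilinear_map k A A A (monoid.mult A)" "\<one>\<^bsub>A\<^esub> \<in> carrier A"
    and "\<And>x y z. \<lbrakk>x \<in> carrier A; y \<in> carrier A; z \<in> carrier A\<rbrakk> \<Longrightarrow>
      (x \<otimes>\<^bsub>A\<^esub> y) \<otimes>\<^bsub>A\<^esub> z = x \<otimes>\<^bsub>A\<^esub> (y \<otimes>\<^bsub>A\<^esub> z)"
    and "\<And>x. x \<in> carrier A \<Longrightarrow> \<one>\<^bsub>A\<^esub> \<otimes>\<^bsub>A\<^esub> x = x"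
    and "\<And>x. x \<in> carrier A \<Longrightarrow> x \<otimes>\<^bsub>A\<^esub> \<one>\<^bsub>A\<^esub> = x"
  shows "associative_algebra k A"
proof -
  interpret module k A by fact
  note D = bilinear_mapD[OF assms(2)]
  have "monoid A"
    using assms(3-) bilinear_map_closed[OF assms(2)] by (intro monoidI) auto
  then have "ring A"
    by (intro ringI) (auto simp: linear_map_add[OF D(1)] linear_map_add[OF D(2)]
        abelian_group_axioms abelian_group.axioms)
  with assms(1) show ?thesis
    by (intro associative_algebra.intro associative_algebra_axioms.intro)
      (auto simp: linear_map_smult[OF D(1)] linear_map_smult[OF D(2)])
qed

lemma (in associative_algebra) mult_bilinear: "bilinear_map R M M M (monoid.mult M)"
  unfolding bilinear_map_def
  by (auto intro!: linear_mapI simp: l_distr r_distr smult_mult_left smult_mult_right)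

lemma algebra_isoI:
  assumes "bij_betw h (carrier A) (carrier B)"
    and "\<And>x y. \<lbrakk>x \<in> carrier A; y \<in> carrier A\<rbrakk> \<Longrightarrow> h (x \<oplus>\<^bsub>A\<^esub> y) = h x \<oplus>\<^bsub>B\<^esub> h y"
    and "\<And>a x. \<lbrakk>a \<in> carrier k; x \<in> carrier A\<rbrakk> \<Longrightarrow> h (a \<odot>\<^bsub>A\<^esub> x) = a \<odot>\<^bsub>B\<^esub> h x"
    and "\<And>x y. \<lbrakk>x \<in> carrier A; y \<in> carrier A\<rbrakk> \<Longrightarrow> h (x \<otimes>\<^bsub>A\<^esub> y) = h x \<otimes>\<^bsub>B\<^esub> h y"
    and "h \<one>\<^bsub>A\<^esub> = \<one>\<^bsub>B\<^esub>"
  shows "h \<in> algebra_iso k A B"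
  using assms unfolding algebra_iso_def
  by (auto intro!: ring_iso_memI linear_mapI simp: bij_betw_apply)

text \<open>\<open>B\<close> starts out as a mere record. Every element of its carrier is some
  \<open>h x\<close>, and the equations are oriented so that operations of \<open>B\<close> are
  pulled inside \<open>h\<close>; each axiom for \<open>B\<close> then becomes the image of the same
  axiom for \<open>A\<close>.\<close>

lemma associative_algebra_transport:
  assumes "associative_algebra k A" "bij_betw h (carrier A) (carrier B)"
    and add: "\<And>x y. \<lbrakk>x \<in> carrier A; y \<in> carrier A\<rbrakk> \<Longrightarrow> h x \<oplus>\<^bsub>B\<^esub> h y = h (x \<oplus>\<^bsub>A\<^esub> y)"
    and smult: "\<And>a x. \<lbrakk>a \<in> carrier k; x \<in> carrier A\<rbrakk> \<Longrightarrow> a \<odot>\<^bsub>B\<^esub> h x = h (a \<odot>\<^bsub>A\<^esub> x)"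
    and mult: "\<And>x y. \<lbrakk>x \<in> carrier A; y \<in> carrier A\<rbrakk> \<Longrightarrow> h x \<otimes>\<^bsub>B\<^esub> h y = h (x \<otimes>\<^bsub>A\<^esub> y)"
    and zero: "\<zero>\<^bsub>B\<^esub> = h \<zero>\<^bsub>A\<^esub>"
    and one: "\<one>\<^bsub>B\<^esub> = h \<one>\<^bsub>A\<^esub>"
  shows "associative_algebra k B" "h \<in> algebra_iso k A B"
proof -
  interpret A: associative_algebra k A by fact
  have carr: "carrier B = h ` carrier A"
    using assms(2) by (simp add: bij_betw_def)
  have ag: "abelian_group B"
  proof (rule abelian_groupI)
    fix x assume "x \<in> carrier B"
    then obtain x' where x': "x = h x'" "x' \<in> carrier A" by (auto simp: carr)
    then have "h (\<ominus>\<^bsub>A\<^esub> x') \<oplus>\<^bsub>B\<^esub> x = \<zero>\<^bsub>B\<^esub>"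
      by (simp add: add zero A.M.l_neg)
    with x' show "\<exists>y\<in>carrier B. y \<oplus>\<^bsub>B\<^esub> x = \<zero>\<^bsub>B\<^esub>" by (auto simp: carr)
  qed (auto simp: carr add zero A.M.a_ac)
  have mo: "module k B"
    by (rule moduleI[OF A.R.is_cring ag])
      (auto simp: carr add smult A.smult_l_distr A.smult_r_distr A.smult_assoc1)
  have "bilinear_map k B B B (monoid.mult B)"
    unfolding bilinear_map_def
    by (auto intro!: linear_mapI simp: carr add smult mult A.l_distr A.r_distr
        A.smult_mult_left A.smult_mult_right)
  with mo show "associative_algebra k B"
    by (rule associative_algebraI) (auto simp: carr one mult A.m_assoc)
  show "h \<in> algebra_iso k A B"
    using assms by (intro algebra_isoI) auto
qed

text \<open>Both comparison isomorphisms start at the convolution algebra, so one of them has to be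
  reversed before they can be composed. The ring part is known for ring isomorphisms; scalars are
  checked on preimages.\<close>

lemma algebra_iso_sym:
  assumes "associative_algebra k A" "h \<in> algebra_iso k A B"
  shows "inv_into (carrier A) h \<in> algebra_iso k B A"
proof -
  interpret associative_algebra k A by fact
  have h: "h \<in> ring_iso A B" "linear_map k A B h" and bij: "bij_betw h (carrier A) (carrier B)"
    using assms(2) by (auto simp: algebra_iso_def ring_iso_def)
  have r: "inv_into (carrier A) h \<in> ring_iso B A"
    using ring_iso_set_sym[OF ring_axioms h(1)] .
  have "inv_into (carrier A) h (a \<odot>\<^bsub>B\<^esub> x) = a \<odot>\<^bsub>A\<^esub> inv_into (carrier A) h x"
    if ax: "a \<in> carrier k" "x \<in> carrier B" for a x
  proof -
    obtain y where y: "y \<in> carrier A" "x = h y"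
      using bij ax(2) by (auto simp: bij_betw_def)
    then have "a \<odot>\<^bsub>B\<^esub> x = h (a \<odot>\<^bsub>A\<^esub> y)"
      using ax(1) by (simp add: linear_map_smult[OF h(2)])
    then show ?thesis
      using y ax(1) bij_betw_inv_into_left[OF bij] by simp
  qed
  with r have "linear_map k B A (inv_into (carrier A) h)"
    by (intro linear_mapI) (auto simp: ring_iso_def ring_hom_def)
  with r show ?thesis by (simp add: algebra_iso_def)
qed

lemma algebra_iso_trans:
  assumes "f \<in> algebra_iso k A B" "g \<in> algebra_iso k B C"
  shows "g \<circ> f \<in> algebra_iso k A C"
  using assms ring_iso_set_trans linear_map_comp unfolding algebra_iso_def comp_def by fastforce

subsection \<open>Direct sums\<close>

lemma module_update_mult_one [simp]:
  "module k (M\<lparr>monoid.mult := p, one := e\<rparr>) \<longleftrightarrow> module k M"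
  unfolding module_def module_axioms_def abelian_group_def abelian_monoid_def abelian_group_axioms_def
  by simp

lemma direct_sum_closed:
  "f \<in> carrier (direct_sum I M) \<Longrightarrow> i \<in> I \<Longrightarrow> f i \<in> carrier (M i)"
  by (auto simp: direct_sum_def)

lemma direct_sum_ext:
  assumes "f \<in> carrier (direct_sum I M)" "g \<in> carrier (direct_sum I N)" "\<And>i. i \<in> I \<Longrightarrow> f i = g i"
  shows "f = g"
  using assms by (auto simp: direct_sum_def PiE_def intro: extensionalityI)

text \<open>Over a finite index set the support condition is automatic.\<close>

lemma direct_sum_memI:
  "\<lbrakk>f \<in> extensional I; \<And>i. i \<in> I \<Longrightarrow> f i \<in> carrier (M i); finite I\<rbrakk> \<Longrightarrow> f \<in> carrier (direct_sum I M)"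
  by (auto simp: direct_sum_def PiE_def)

lemma direct_sum_apply:
  assumes "i \<in> I"
  shows "(f \<oplus>\<^bsub>direct_sum I M\<^esub> g) i = f i \<oplus>\<^bsub>M i\<^esub> g i"
    and "\<zero>\<^bsub>direct_sum I M\<^esub> i = \<zero>\<^bsub>M i\<^esub>"
    and "(a \<odot>\<^bsub>direct_sum I M\<^esub> f) i = a \<odot>\<^bsub>M i\<^esub> f i"
  using assms by (auto simp: direct_sum_def)

lemma module_direct_sum:
  assumes "cring k" "\<And>i. i \<in> I \<Longrightarrow> module k (M i)"
  shows "module k (direct_sum I M)"
proof -
  let ?D = "direct_sum I M"
  have ag: "abelian_group (M i)" if "i \<in> I" for i
    using assms(2)[OF that] by (rule module.axioms)
  have am: "abelian_monoid (M i)" if "i \<in> I" for i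
    using ag[OF that] by (rule abelian_group.axioms)
  note simps = abelian_monoid.a_closed[OF am] abelian_monoid.zero_closed[OF am]
    abelian_monoid.l_zero[OF am] abelian_monoid.r_zero[OF am] abelian_group.a_inv_closed[OF ag]
    module.smult_closed[OF assms(2)] module.smult_r_null[OF assms(2)]
  \<comment> \<open>The index set may be infinite here. It suffices to enclose each support in a
    finite set \<open>J\<close>: the union of two supports for sums, the old support for scalar
    multiples and negatives.\<close>
  have memI: "f \<in> carrier ?D"
    if "f \<in> extensional I" "\<And>i. i \<in> I \<Longrightarrow> f i \<in> carrier (M i)"
      "{i \<in> I. f i \<noteq> \<zero>\<^bsub>M i\<^esub>} \<subseteq> J" "finite J" for f J
    using that finite_subset[OF that(3,4)] by (auto simp: direct_sum_def PiE_def)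
  have fin: "finite {i \<in> I. f i \<noteq> \<zero>\<^bsub>M i\<^esub>}" if "f \<in> carrier ?D" for f
    using that by (simp add: direct_sum_def)
  have addc: "f \<oplus>\<^bsub>?D\<^esub> g \<in> carrier ?D" if "f \<in> carrier ?D" "g \<in> carrier ?D" for f g
  proof (rule memI)
    show "f \<oplus>\<^bsub>?D\<^esub> g \<in> extensional I"
      by (simp add: direct_sum_def)
    show "finite ({i \<in> I. f i \<noteq> \<zero>\<^bsub>M i\<^esub>} \<union> {i \<in> I. g i \<noteq> \<zero>\<^bsub>M i\<^esub>})"
      using fin that by blast
  qed (use that in \<open>auto simp: direct_sum_apply direct_sum_closed simps\<close>)
  have smc: "a \<odot>\<^bsub>?D\<^esub> f \<in> carrier ?D" if "f \<in> carrier ?D" "a \<in> carrier k" for f a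
  proof (rule memI[OF _ _ _ fin[OF that(1)]])
    show "a \<odot>\<^bsub>?D\<^esub> f \<in> extensional I"
      by (simp add: direct_sum_def)
  qed (use that fin in \<open>auto simp: direct_sum_apply direct_sum_closed simps\<close>)
  have zc: "\<zero>\<^bsub>?D\<^esub> \<in> carrier ?D"
    by (auto simp: direct_sum_def simps)
  note ext = direct_sum_ext[of _ I M _ M]
  show ?thesis
  proof (rule moduleI[OF assms(1)])
    show "abelian_group ?D"
    proof (rule abelian_groupI)
      fix f assume f: "f \<in> carrier ?D"
      let ?g = "\<lambda>i\<in>I. \<ominus>\<^bsub>M i\<^esub> f i"
      have "\<ominus>\<^bsub>M i\<^esub> f i = \<zero>\<^bsub>M i\<^esub>" if "i \<in> I" "f i = \<zero>\<^bsub>M i\<^esub>" for i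
        using that by (simp add: abelian_group.minus_equality ag simps)
      with f have g: "?g \<in> carrier ?D"
        by (intro memI[OF _ _ _ fin[OF f]]) (auto simp: direct_sum_closed simps)
      moreover from f g have "?g \<oplus>\<^bsub>?D\<^esub> f = \<zero>\<^bsub>?D\<^esub>"
        by (intro ext addc zc)
          (auto simp: direct_sum_apply abelian_group.l_neg[OF ag] direct_sum_closed)
      ultimately show "\<exists>g\<in>carrier ?D. g \<oplus>\<^bsub>?D\<^esub> f = \<zero>\<^bsub>?D\<^esub>" by blast
    next
      fix f g h assume "f \<in> carrier ?D" "g \<in> carrier ?D" "h \<in> carrier ?D"
      then show "f \<oplus>\<^bsub>?D\<^esub> g \<oplus>\<^bsub>?D\<^esub> h = f \<oplus>\<^bsub>?D\<^esub> (g \<oplus>\<^bsub>?D\<^esub> h)"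
        by (intro ext addc)
          (auto simp: direct_sum_apply abelian_monoid.a_assoc[OF am] direct_sum_closed)
    next
      fix f g assume "f \<in> carrier ?D" "g \<in> carrier ?D"
      then show "f \<oplus>\<^bsub>?D\<^esub> g = g \<oplus>\<^bsub>?D\<^esub> f"
        by (intro ext addc)
          (auto simp: direct_sum_apply abelian_monoid.a_comm[OF am] direct_sum_closed)
    next
      fix f assume "f \<in> carrier ?D"
      then show "\<zero>\<^bsub>?D\<^esub> \<oplus>\<^bsub>?D\<^esub> f = f"
        by (intro ext addc zc) (auto simp: direct_sum_apply simps direct_sum_closed)
    qed (auto simp: addc zc)
  next
    fix a b f assume "a \<in> carrier k" "b \<in> carrier k" "f \<in> carrier ?D"
    moreover from this have "a \<oplus>\<^bsub>k\<^esub> b \<in> carrier k" "a \<otimes>\<^bsub>k\<^esub> b \<in> carrier k"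
      using assms(1) by (auto simp: cring_def ring.ring_simprules)
    ultimately show "(a \<oplus>\<^bsub>k\<^esub> b) \<odot>\<^bsub>?D\<^esub> f = a \<odot>\<^bsub>?D\<^esub> f \<oplus>\<^bsub>?D\<^esub> b \<odot>\<^bsub>?D\<^esub> f"
      and "(a \<otimes>\<^bsub>k\<^esub> b) \<odot>\<^bsub>?D\<^esub> f = a \<odot>\<^bsub>?D\<^esub> (b \<odot>\<^bsub>?D\<^esub> f)"
      by (auto intro!: ext addc smc simp: direct_sum_apply direct_sum_closed
          module.smult_l_distr[OF assms(2)] module.smult_assoc1[OF assms(2)])
  next
    fix a f g assume "a \<in> carrier k" "f \<in> carrier ?D" "g \<in> carrier ?D"
    then show "a \<odot>\<^bsub>?D\<^esub> (f \<oplus>\<^bsub>?D\<^esub> g) = a \<odot>\<^bsub>?D\<^esub> f \<oplus>\<^bsub>?D\<^esub> a \<odot>\<^bsub>?D\<^esub> g"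
      by (auto intro!: ext addc smc simp: direct_sum_apply direct_sum_closed
          module.smult_r_distr[OF assms(2)])
  next
    fix f assume "f \<in> carrier ?D"
    moreover have "\<one>\<^bsub>k\<^esub> \<in> carrier k"
      using assms(1) by (auto simp: cring_def ring.ring_simprules)
    ultimately show "\<one>\<^bsub>k\<^esub> \<odot>\<^bsub>?D\<^esub> f = f"
      by (auto intro!: ext smc simp: direct_sum_apply direct_sum_closed module.smult_one[OF assms(2)])
  qed (auto simp: smc)
qed

text \<open>Evaluation at \<open>i\<close> is a linear map from the direct sum to its summand, hence
  commutes with finite sums.\<close>

lemma finsum_direct_sum_apply:
  assumes "cring k" "\<And>i. i \<in> I \<Longrightarrow> module k (M i)"
    and "i \<in> I" "F \<in> J \<rightarrow> carrier (direct_sum I M)"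
  shows "finsum (direct_sum I M) F J i = (\<Oplus>\<^bsub>M i\<^esub>j\<in>J. F j i)"
proof (rule linear_map_finsum[where h = "\<lambda>f. f i"])
  show "linear_map k (direct_sum I M) (M i) (\<lambda>f. f i)"
    using assms by (intro linear_mapI) (auto simp: direct_sum_apply direct_sum_closed)
  show "abelian_group (direct_sum I M)" "abelian_group (M i)"
    using module.axioms(2)[OF module_direct_sum[of k I M]] module.axioms(2)[of k "M i"] assms(1-3)
    by blast+
qed (use assms in auto)

section \<open>The algebra of a category with finitely many objects\<close>

lemma carrier_category_algebra:
  "carrier (category_algebra C) = carrier (direct_sum (Ob C \<times> Ob C) (\<lambda>(y, x). Mor C y x))"
  by (simp add: category_algebra_def)

lemma category_algebra_closed:
  "\<lbrakk>f \<in> carrier (category_algebra C); y \<in> Ob C; x \<in> Ob C\<rbrakk> \<Longrightarrow> f (y, x) \<in> carrier (Mor C y x)"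
  using direct_sum_closed[of f "Ob C \<times> Ob C" "\<lambda>(y, x). Mor C y x" "(y, x)"]
  by (simp add: carrier_category_algebra)

lemma category_algebra_memI:
  "\<lbrakk>f \<in> extensional (Ob C \<times> Ob C); \<And>y x. \<lbrakk>y \<in> Ob C; x \<in> Ob C\<rbrakk> \<Longrightarrow> f (y, x) \<in> carrier (Mor C y x);
    finite (Ob C)\<rbrakk> \<Longrightarrow> f \<in> carrier (category_algebra C)"
  by (auto simp: carrier_category_algebra intro!: direct_sum_memI)

lemma category_algebra_ext:
  assumes "f \<in> carrier (category_algebra C)" "g \<in> carrier (category_algebra C)"
    and "\<And>y x. \<lbrakk>y \<in> Ob C; x \<in> Ob C\<rbrakk> \<Longrightarrow> f (y, x) = g (y, x)"
  shows "f = g"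
  using assms by (auto simp: carrier_category_algebra intro: direct_sum_ext)

lemma category_algebra_apply:
  assumes "z \<in> Ob C" "x \<in> Ob C"
  shows "(g \<otimes>\<^bsub>category_algebra C\<^esub> f) (z, x) = (\<Oplus>\<^bsub>Mor C z x\<^esub>y\<in>Ob C. Cmp C z y x (g (z, y)) (f (y, x)))"
    and "\<one>\<^bsub>category_algebra C\<^esub> (z, x) = (if z = x then Idt C x else \<zero>\<^bsub>Mor C z x\<^esub>)"
    and "(g \<oplus>\<^bsub>category_algebra C\<^esub> f) (z, x) = g (z, x) \<oplus>\<^bsub>Mor C z x\<^esub> f (z, x)"
    and "\<zero>\<^bsub>category_algebra C\<^esub> (z, x) = \<zero>\<^bsub>Mor C z x\<^esub>"
    and "(a \<odot>\<^bsub>category_algebra C\<^esub> f) (z, x) = a \<odot>\<^bsub>Mor C z x\<^esub> f (z, x)"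
  using assms by (auto simp: category_algebra_def direct_sum_apply)

lemma category_algebra_extensional:
  "g \<otimes>\<^bsub>category_algebra C\<^esub> f \<in> extensional (Ob C \<times> Ob C)"
  "\<one>\<^bsub>category_algebra C\<^esub> \<in> extensional (Ob C \<times> Ob C)"
  "g \<oplus>\<^bsub>category_algebra C\<^esub> f \<in> extensional (Ob C \<times> Ob C)"
  "\<zero>\<^bsub>category_algebra C\<^esub> \<in> extensional (Ob C \<times> Ob C)"
  "a \<odot>\<^bsub>category_algebra C\<^esub> f \<in> extensional (Ob C \<times> Ob C)"
  by (simp_all add: category_algebra_def direct_sum_def)

context category_over
begin

lemma Mor_abelian_group: "\<lbrakk>x \<in> Ob C; y \<in> Ob C\<rbrakk> \<Longrightarrow> abelian_group (Mor C y x)"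
  using Mor_module by (rule module.axioms)

lemma Mor_abelian_monoid: "\<lbrakk>x \<in> Ob C; y \<in> Ob C\<rbrakk> \<Longrightarrow> abelian_monoid (Mor C y x)"
  using Mor_abelian_group by (rule abelian_group.axioms)

lemma Cmp_closed:
  "\<lbrakk>x \<in> Ob C; y \<in> Ob C; z \<in> Ob C; g \<in> carrier (Mor C z y); f \<in> carrier (Mor C y x)\<rbrakk> \<Longrightarrow>
    Cmp C z y x g f \<in> carrier (Mor C z x)"
  using Cmp_bilinear bilinear_map_closed by metis

lemma Cmp_finsum_left:
  assumes "x \<in> Ob C" "y \<in> Ob C" "z \<in> Ob C"
    and "g \<in> J \<rightarrow> carrier (Mor C z y)" "f \<in> carrier (Mor C y x)"
  shows "Cmp C z y x (finsum (Mor C z y) g J) f = (\<Oplus>\<^bsub>Mor C z x\<^esub>j\<in>J. Cmp C z y x (g j) f)"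
  using linear_map_finsum[OF bilinear_map_left[OF Cmp_bilinear]] assms Mor_abelian_group by metis

lemma Cmp_finsum_right:
  assumes "x \<in> Ob C" "y \<in> Ob C" "z \<in> Ob C"
    and "g \<in> carrier (Mor C z y)" "f \<in> J \<rightarrow> carrier (Mor C y x)"
  shows "Cmp C z y x g (finsum (Mor C y x) f J) = (\<Oplus>\<^bsub>Mor C z x\<^esub>j\<in>J. Cmp C z y x g (f j))"
  using linear_map_finsum[OF bilinear_map_right[OF Cmp_bilinear]] assms Mor_abelian_group by metis

lemma Cmp_zero:
  assumes "x \<in> Ob C" "y \<in> Ob C" "z \<in> Ob C"
  shows "f \<in> carrier (Mor C y x) \<Longrightarrow> Cmp C z y x \<zero>\<^bsub>Mor C z y\<^esub> f = \<zero>\<^bsub>Mor C z x\<^esub>"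
    and "g \<in> carrier (Mor C z y) \<Longrightarrow> Cmp C z y x g \<zero>\<^bsub>Mor C y x\<^esub> = \<zero>\<^bsub>Mor C z x\<^esub>"
  using linear_map_zero[OF bilinear_map_left[OF Cmp_bilinear]]
    linear_map_zero[OF bilinear_map_right[OF Cmp_bilinear]] assms Mor_abelian_group by metis+

lemma module_category_algebra: "module k (category_algebra C)"
  unfolding category_algebra_def
  by (simp del: split_paired_All) (rule module_direct_sum[OF is_cring], auto intro: Mor_module)

text \<open>This is matrix multiplication. Associativity is \<open>Cmp_assoc\<close> after
  exchanging the sums over the two intermediate objects; in the unit laws a single summand survives,
  since composing with a zero morphism gives zero.\<close>

lemma category_algebra_associative:
  assumes fin: "finite (Ob C)"
  shows "associative_algebra k (category_algebra C)"
proof -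
  let ?A = "category_algebra C"
  interpret A: module k ?A by (rule module_category_algebra)
  note cl = category_algebra_closed and ap = category_algebra_apply
  note fsc = abelian_monoid.finsum_closed[OF Mor_abelian_monoid]
  have mc: "g \<otimes>\<^bsub>?A\<^esub> f \<in> carrier ?A" if "g \<in> carrier ?A" "f \<in> carrier ?A" for f g
    using that
    by (intro category_algebra_memI[of _ C] category_algebra_extensional fin)
      (auto simp: ap cl Cmp_closed intro!: fsc)
  have oc: "\<one>\<^bsub>?A\<^esub> \<in> carrier ?A"
    by (intro category_algebra_memI[of _ C] category_algebra_extensional fin)
      (auto simp: ap Idt_closed abelian_monoid.zero_closed[OF Mor_abelian_monoid])
  note L = bilinear_map_left[OF Cmp_bilinear] and R = bilinear_map_right[OF Cmp_bilinear]
  show ?thesis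
  proof (rule associative_algebraI[OF module_category_algebra _ oc])
    show "bilinear_map k ?A ?A ?A (monoid.mult ?A)"
      unfolding bilinear_map_def
    proof (intro conjI ballI linear_mapI mc)
      fix h g f assume H: "h \<in> carrier ?A" "g \<in> carrier ?A" "f \<in> carrier ?A"
      show "h \<otimes>\<^bsub>?A\<^esub> (g \<oplus>\<^bsub>?A\<^esub> f) = h \<otimes>\<^bsub>?A\<^esub> g \<oplus>\<^bsub>?A\<^esub> h \<otimes>\<^bsub>?A\<^esub> f"
        using H
        by (intro category_algebra_ext[of _ C] mc A.M.a_closed)
          (auto simp: ap cl Cmp_closed Pi_iff linear_map_add[OF R]
            simp flip: abelian_monoid.finsum_addf[OF Mor_abelian_monoid]
            intro!: abelian_monoid.finsum_cong'[OF Mor_abelian_monoid]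
              abelian_monoid.a_closed[OF Mor_abelian_monoid])
      show "(g \<oplus>\<^bsub>?A\<^esub> f) \<otimes>\<^bsub>?A\<^esub> h = g \<otimes>\<^bsub>?A\<^esub> h \<oplus>\<^bsub>?A\<^esub> f \<otimes>\<^bsub>?A\<^esub> h"
        using H
        by (intro category_algebra_ext[of _ C] mc A.M.a_closed)
          (auto simp: ap cl Cmp_closed Pi_iff linear_map_add[OF L]
            simp flip: abelian_monoid.finsum_addf[OF Mor_abelian_monoid]
            intro!: abelian_monoid.finsum_cong'[OF Mor_abelian_monoid]
              abelian_monoid.a_closed[OF Mor_abelian_monoid])
    next
      fix a g f assume H: "a \<in> carrier k" "g \<in> carrier ?A" "f \<in> carrier ?A"
      show "g \<otimes>\<^bsub>?A\<^esub> (a \<odot>\<^bsub>?A\<^esub> f) = a \<odot>\<^bsub>?A\<^esub> (g \<otimes>\<^bsub>?A\<^esub> f)"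
        using H fin
        by (intro category_algebra_ext[of _ C] mc A.smult_closed)
          (auto simp: ap cl Cmp_closed Pi_iff linear_map_smult[OF R]
            module.finsum_smult_ldistr[OF Mor_module]
            intro!: abelian_monoid.finsum_cong'[OF Mor_abelian_monoid]
              module.smult_closed[OF Mor_module])
      show "(a \<odot>\<^bsub>?A\<^esub> f) \<otimes>\<^bsub>?A\<^esub> g = a \<odot>\<^bsub>?A\<^esub> (f \<otimes>\<^bsub>?A\<^esub> g)"
        using H fin
        by (intro category_algebra_ext[of _ C] mc A.smult_closed)
          (auto simp: ap cl Cmp_closed Pi_iff linear_map_smult[OF L]
            module.finsum_smult_ldistr[OF Mor_module]
            intro!: abelian_monoid.finsum_cong'[OF Mor_abelian_monoid]
              module.smult_closed[OF Mor_module])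
    qed
  next
    fix h g f assume H: "h \<in> carrier ?A" "g \<in> carrier ?A" "f \<in> carrier ?A"
    show "h \<otimes>\<^bsub>?A\<^esub> g \<otimes>\<^bsub>?A\<^esub> f = h \<otimes>\<^bsub>?A\<^esub> (g \<otimes>\<^bsub>?A\<^esub> f)"
    proof (intro category_algebra_ext[of _ C] mc H)
      fix z w assume zw: "z \<in> Ob C" "w \<in> Ob C"
      interpret M: abelian_monoid "Mor C z w" by (rule Mor_abelian_monoid[OF zw(2,1)])
      have "(h \<otimes>\<^bsub>?A\<^esub> g \<otimes>\<^bsub>?A\<^esub> f) (z, w) =
          (\<Oplus>\<^bsub>Mor C z w\<^esub>x\<in>Ob C. \<Oplus>\<^bsub>Mor C z w\<^esub>y\<in>Ob C. Cmp C z x w (Cmp C z y x (h (z, y)) (g (y, x))) (f (x, w)))"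
        using zw H
        by (auto simp: ap Cmp_finsum_left Pi_iff Cmp_closed cl intro!: M.finsum_cong' M.finsum_closed)
      also have "\<dots> =
          (\<Oplus>\<^bsub>Mor C z w\<^esub>x\<in>Ob C. \<Oplus>\<^bsub>Mor C z w\<^esub>y\<in>Ob C. Cmp C z y w (h (z, y)) (Cmp C y x w (g (y, x)) (f (x, w))))"
        using zw H
        by (auto simp: Cmp_assoc Pi_iff Cmp_closed cl intro!: M.finsum_cong' M.finsum_closed)
      also have "\<dots> =
          (\<Oplus>\<^bsub>Mor C z w\<^esub>y\<in>Ob C. \<Oplus>\<^bsub>Mor C z w\<^esub>x\<in>Ob C. Cmp C z y w (h (z, y)) (Cmp C y x w (g (y, x)) (f (x, w))))"
        using zw H by (intro M.finsum_swap fin Cmp_closed cl)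
      also have "\<dots> = (h \<otimes>\<^bsub>?A\<^esub> (g \<otimes>\<^bsub>?A\<^esub> f)) (z, w)"
        using zw H
        by (auto simp: ap Cmp_finsum_right Pi_iff Cmp_closed cl intro!: M.finsum_cong' M.finsum_closed)
      finally show "(h \<otimes>\<^bsub>?A\<^esub> g \<otimes>\<^bsub>?A\<^esub> f) (z, w) = (h \<otimes>\<^bsub>?A\<^esub> (g \<otimes>\<^bsub>?A\<^esub> f)) (z, w)" .
    qed
  next
    fix f assume f: "f \<in> carrier ?A"
    show "\<one>\<^bsub>?A\<^esub> \<otimes>\<^bsub>?A\<^esub> f = f"
    proof (intro category_algebra_ext[of _ C] mc f oc)
      fix z x assume zx: "z \<in> Ob C" "x \<in> Ob C"
      show "(\<one>\<^bsub>?A\<^esub> \<otimes>\<^bsub>?A\<^esub> f) (z, x) = f (z, x)"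
        unfolding ap(1)[OF zx]
        by (rule abelian_monoid.finsum_delta[OF Mor_abelian_monoid, where i = z])
          (use zx f fin in \<open>auto simp: ap cl Cmp_zero Idt_left\<close>)
    qed
    show "f \<otimes>\<^bsub>?A\<^esub> \<one>\<^bsub>?A\<^esub> = f"
    proof (intro category_algebra_ext[of _ C] mc f oc)
      fix z x assume zx: "z \<in> Ob C" "x \<in> Ob C"
      show "(f \<otimes>\<^bsub>?A\<^esub> \<one>\<^bsub>?A\<^esub>) (z, x) = f (z, x)"
        unfolding ap(1)[OF zx]
        by (rule abelian_monoid.finsum_delta[OF Mor_abelian_monoid, where i = x])
          (use zx f fin in \<open>auto simp: ap cl Cmp_zero Idt_right\<close>)
    qed
  qed
qed

end

section \<open>The action of \<open>G\<close> on the algebra \<open>a(C)\<close>\<close>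

context G_category
begin

lemma G_is_group: "group G"
  using group_hom by (rule group_hom.axioms)

lemma act_ob_closed [simp]: "\<lbrakk>s \<in> carrier G; x \<in> Ob C\<rbrakk> \<Longrightarrow> act_ob C s x \<in> Ob C"
  using element_image by blast

lemma act_ob_one [simp]: "x \<in> Ob C \<Longrightarrow> act_ob C \<one>\<^bsub>G\<^esub> x = x"
  by (metis id_eq_one restrict_apply')

lemma act_ob_inv_left [simp]:
  "\<lbrakk>s \<in> carrier G; x \<in> Ob C\<rbrakk> \<Longrightarrow> act_ob C (inv\<^bsub>G\<^esub> s) (act_ob C s x) = x"
  using orbit_sym_aux by blast

lemma act_ob_inv_right [simp]:
  "\<lbrakk>s \<in> carrier G; x \<in> Ob C\<rbrakk> \<Longrightarrow> act_ob C s (act_ob C (inv\<^bsub>G\<^esub> s) x) = x"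
  using orbit_sym_aux[of "inv\<^bsub>G\<^esub> s" x] G_is_group by (simp add: group.inv_inv group.inv_closed)

lemma act_ob_bij_betw: "s \<in> carrier G \<Longrightarrow> bij_betw (act_ob C s) (Ob C) (Ob C)"
  using bij_prop0 by (simp add: Bij_def)

lemma act_mor_closed:
  "\<lbrakk>s \<in> carrier G; x \<in> Ob C; y \<in> Ob C; f \<in> carrier (Mor C y x)\<rbrakk> \<Longrightarrow>
    act_mor C s y x f \<in> carrier (Mor C (act_ob C s y) (act_ob C s x))"
  using act_mor_linear linear_map_closed by metis

text \<open>Every pair of objects has the form \<open>(s y, s x)\<close>, since \<open>s\<close>
  permutes the objects. At these positions the inverses in \<open>category_algebra_action\<close>
  cancel, so the action can be computed without them.\<close>

lemma category_algebra_ext_act: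
  assumes "s \<in> carrier G" "f \<in> carrier (category_algebra C)" "g \<in> carrier (category_algebra C)"
    and "\<And>y x. \<lbrakk>y \<in> Ob C; x \<in> Ob C\<rbrakk> \<Longrightarrow>
      f (act_ob C s y, act_ob C s x) = g (act_ob C s y, act_ob C s x)"
  shows "f = g"
proof (rule category_algebra_ext[OF assms(2,3)])
  fix y x assume "y \<in> Ob C" "x \<in> Ob C"
  then show "f (y, x) = g (y, x)"
    using assms(1) assms(4)[of "act_ob C (inv\<^bsub>G\<^esub> s) y" "act_ob C (inv\<^bsub>G\<^esub> s) x"] G_is_group
    by (simp add: group.inv_closed)
qed

lemma category_algebra_action_apply:
  assumes "s \<in> carrier G" "f \<in> carrier (category_algebra C)" "y \<in> Ob C" "x \<in> Ob C"
  shows "category_algebra_action G C s f (act_ob C s y, act_ob C s x) = act_mor C s y x (f (y, x))"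
  using assms by (simp add: category_algebra_action_def)

lemma category_algebra_action_closed:
  assumes "finite (Ob C)" "s \<in> carrier G" "f \<in> carrier (category_algebra C)"
  shows "category_algebra_action G C s f \<in> carrier (category_algebra C)"
proof (rule category_algebra_memI[OF _ _ assms(1)])
  show "category_algebra_action G C s f \<in> extensional (Ob C \<times> Ob C)"
    using assms(3) by (simp add: category_algebra_action_def)
  fix y x assume yx: "y \<in> Ob C" "x \<in> Ob C"
  have i: "inv\<^bsub>G\<^esub> s \<in> carrier G"
    using assms(2) G_is_group by (simp add: group.inv_closed)
  show "category_algebra_action G C s f (y, x) \<in> carrier (Mor C y x)"
    using act_mor_closed[OF assms(2) act_ob_closed[OF i yx(2)] act_ob_closed[OF i yx(1)]]
      category_algebra_closed[OF assms(3)] yx assms(2,3) i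
    by (simp add: category_algebra_action_def Let_def)
qed

lemma acts_by_algebra_automorphisms_category_algebra:
  assumes fin: "finite (Ob C)"
  shows "acts_by_algebra_automorphisms k G (category_algebra C) (category_algebra_action G C)"
proof -
  let ?A = "category_algebra C" and ?\<alpha> = "category_algebra_action G C"
  interpret G: group G by (rule G_is_group)
  interpret A: associative_algebra k ?A by (rule category_algebra_associative[OF fin])
  note \<alpha>c = category_algebra_action_closed[OF fin]
  note simps = category_algebra_action_apply category_algebra_apply category_algebra_closed
  have comp: "?\<alpha> (t \<otimes>\<^bsub>G\<^esub> s) f = ?\<alpha> t (?\<alpha> s f)"
    if "t \<in> carrier G" "s \<in> carrier G" "f \<in> carrier ?A" for t s f
  proof (rule category_algebra_ext_act[of "t \<otimes>\<^bsub>G\<^esub> s"])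
    fix y x assume yx: "y \<in> Ob C" "x \<in> Ob C"
    have "?\<alpha> (t \<otimes>\<^bsub>G\<^esub> s) f (act_ob C (t \<otimes>\<^bsub>G\<^esub> s) y, act_ob C (t \<otimes>\<^bsub>G\<^esub> s) x) =
        act_mor C (t \<otimes>\<^bsub>G\<^esub> s) y x (f (y, x))"
      using that yx by (intro category_algebra_action_apply) auto
    \<comment> \<open>Once the position is rewritten as \<open>(t (s y), t (s x))\<close>, the
      evaluation rule for the action applies twice.\<close>
    also have "\<dots> = ?\<alpha> t (?\<alpha> s f) (act_ob C (t \<otimes>\<^bsub>G\<^esub> s) y, act_ob C (t \<otimes>\<^bsub>G\<^esub> s) x)"
      using that yx by (simp add: composition_rule simps \<alpha>c act_mor_mult)
    finally show "?\<alpha> (t \<otimes>\<^bsub>G\<^esub> s) f (act_ob C (t \<otimes>\<^bsub>G\<^esub> s) y, act_ob C (t \<otimes>\<^bsub>G\<^esub> s) x) =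
        ?\<alpha> t (?\<alpha> s f) (act_ob C (t \<otimes>\<^bsub>G\<^esub> s) y, act_ob C (t \<otimes>\<^bsub>G\<^esub> s) x)" .
  qed (use that \<alpha>c in auto)
  have one: "?\<alpha> \<one>\<^bsub>G\<^esub> f = f" if "f \<in> carrier ?A" for f
  proof (rule category_algebra_ext_act[of "\<one>\<^bsub>G\<^esub>"])
    fix y x assume yx: "y \<in> Ob C" "x \<in> Ob C"
    show "?\<alpha> \<one>\<^bsub>G\<^esub> f (act_ob C \<one>\<^bsub>G\<^esub> y, act_ob C \<one>\<^bsub>G\<^esub> x) = f (act_ob C \<one>\<^bsub>G\<^esub> y, act_ob C \<one>\<^bsub>G\<^esub> x)"
      unfolding category_algebra_action_apply[OF G.one_closed that yx]
      using that yx by (simp add: act_mor_one simps)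
  qed (use that \<alpha>c in auto)
  have bij: "bij_betw (?\<alpha> s) (carrier ?A) (carrier ?A)" if s: "s \<in> carrier G" for s
    by (rule bij_betw_byWitness[where f' = "?\<alpha> (inv\<^bsub>G\<^esub> s)"])
      (auto simp: \<alpha>c one s simp flip: comp)
  \<comment> \<open>\<open>Bij\<close> admits only extensional maps; the restriction to the carrier
    built into \<open>category_algebra_action\<close> provides this.\<close>
  have Bij: "?\<alpha> s \<in> Bij (carrier ?A)" if s: "s \<in> carrier G" for s
    using bij[OF s] by (simp add: Bij_def category_algebra_action_def)
  have "?\<alpha> \<in> hom G (BijGroup (carrier ?A))"
  proof (rule homI)
    fix t s assume ts: "t \<in> carrier G" "s \<in> carrier G"
    have "compose (carrier ?A) (?\<alpha> t) (?\<alpha> s) = ?\<alpha> (t \<otimes>\<^bsub>G\<^esub> s)"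
      using ts Bij[of "t \<otimes>\<^bsub>G\<^esub> s"]
      by (intro extensionalityI[of _ "carrier ?A"]) (auto simp: compose_eq comp Bij_def)
    with ts show "?\<alpha> (t \<otimes>\<^bsub>G\<^esub> s) = ?\<alpha> t \<otimes>\<^bsub>BijGroup (carrier ?A)\<^esub> ?\<alpha> s"
      by (simp add: BijGroup_def Bij)
  qed (simp add: BijGroup_def Bij)
  then have act: "group_action G (carrier ?A) ?\<alpha>"
    by (intro group_action.intro group_hom.intro group_hom_axioms.intro group_BijGroup G.is_group)
  have "?\<alpha> s \<in> algebra_iso k ?A ?A" if s: "s \<in> carrier G" for s
  proof -
    note lin = act_mor_linear[OF s]
    have mult: "?\<alpha> s (g \<otimes>\<^bsub>?A\<^esub> f) = ?\<alpha> s g \<otimes>\<^bsub>?A\<^esub> ?\<alpha> s f"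
      if H: "g \<in> carrier ?A" "f \<in> carrier ?A" for g f
    proof (rule category_algebra_ext_act[OF s])
      fix z x assume zx: "z \<in> Ob C" "x \<in> Ob C"
      let ?M = "Mor C (act_ob C s z) (act_ob C s x)"
      interpret M: abelian_group ?M
        using zx s by (intro Mor_abelian_group) auto
      have "?\<alpha> s (g \<otimes>\<^bsub>?A\<^esub> f) (act_ob C s z, act_ob C s x) =
          act_mor C s z x (\<Oplus>\<^bsub>Mor C z x\<^esub>y\<in>Ob C. Cmp C z y x (g (z, y)) (f (y, x)))"
        using s H zx by (simp add: simps)
      also have "\<dots> = (\<Oplus>\<^bsub>?M\<^esub>y\<in>Ob C. act_mor C s z x (Cmp C z y x (g (z, y)) (f (y, x))))"
        using H zx
        by (intro linear_map_finsum[OF lin] Mor_abelian_group M.abelian_group_axioms)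
          (auto simp: Cmp_closed category_algebra_closed)
      also have "\<dots> = (\<Oplus>\<^bsub>?M\<^esub>y\<in>Ob C. Cmp C (act_ob C s z) (act_ob C s y) (act_ob C s x)
          (?\<alpha> s g (act_ob C s z, act_ob C s y)) (?\<alpha> s f (act_ob C s y, act_ob C s x)))"
        using s H zx
        by (intro M.finsum_cong') (auto simp: simps act_mor_Cmp intro!: Cmp_closed act_mor_closed)
      \<comment> \<open>The intermediate object \<open>s y\<close> runs through all objects exactly
        once, so it is renamed to \<open>y\<close>.\<close>
      also have "\<dots> = (\<Oplus>\<^bsub>?M\<^esub>y\<in>Ob C. Cmp C (act_ob C s z) y (act_ob C s x)
          (?\<alpha> s g (act_ob C s z, y)) (?\<alpha> s f (y, act_ob C s x)))"
        using s H zx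
        by (intro M.finsum_bij_betw[OF act_ob_bij_betw, symmetric])
          (auto simp: Cmp_closed category_algebra_closed \<alpha>c)
      also have "\<dots> = (?\<alpha> s g \<otimes>\<^bsub>?A\<^esub> ?\<alpha> s f) (act_ob C s z, act_ob C s x)"
        using s zx by (simp add: category_algebra_apply)
      finally show "?\<alpha> s (g \<otimes>\<^bsub>?A\<^esub> f) (act_ob C s z, act_ob C s x) =
          (?\<alpha> s g \<otimes>\<^bsub>?A\<^esub> ?\<alpha> s f) (act_ob C s z, act_ob C s x)" .
    qed (use s H \<alpha>c in auto)
    show ?thesis
    proof (rule algebra_isoI[OF bij[OF s]])
      \<comment> \<open>Preservation of the unit is deduced from multiplicativity and surjectivity:
        if \<open>s\<close> sends \<open>e\<close> to 1, then s(1) = s(1) s(e) = s(1 e) = s(e) =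
        1.\<close>
      have "\<one>\<^bsub>?A\<^esub> \<in> ?\<alpha> s ` carrier ?A"
        using bij[OF s] A.one_closed by (simp add: bij_betw_def)
      then obtain e where e: "e \<in> carrier ?A" "?\<alpha> s e = \<one>\<^bsub>?A\<^esub>"
        by auto
      have "?\<alpha> s \<one>\<^bsub>?A\<^esub> = ?\<alpha> s \<one>\<^bsub>?A\<^esub> \<otimes>\<^bsub>?A\<^esub> ?\<alpha> s e"
        using s by (simp add: e \<alpha>c)
      also have "\<dots> = ?\<alpha> s (\<one>\<^bsub>?A\<^esub> \<otimes>\<^bsub>?A\<^esub> e)"
        using mult[OF A.one_closed e(1)] by simp
      also have "\<dots> = \<one>\<^bsub>?A\<^esub>"
        using e by simp
      finally show "?\<alpha> s \<one>\<^bsub>?A\<^esub> = \<one>\<^bsub>?A\<^esub>" .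
    next
      fix g f assume H: "g \<in> carrier ?A" "f \<in> carrier ?A"
      then show "?\<alpha> s (g \<oplus>\<^bsub>?A\<^esub> f) = ?\<alpha> s g \<oplus>\<^bsub>?A\<^esub> ?\<alpha> s f"
        by (intro category_algebra_ext_act[OF s] \<alpha>c[OF s] A.M.a_closed)
          (auto simp: simps s linear_map_add[OF lin])
    next
      fix a f assume H: "a \<in> carrier k" "f \<in> carrier ?A"
      then show "?\<alpha> s (a \<odot>\<^bsub>?A\<^esub> f) = a \<odot>\<^bsub>?A\<^esub> ?\<alpha> s f"
        by (intro category_algebra_ext_act[OF s] \<alpha>c[OF s] A.smult_closed)
          (auto simp: simps s linear_map_smult[OF lin])
    qed (rule mult)
  qed
  with act A.associative_algebra_axioms show ?thesis
    by (simp add: acts_by_algebra_automorphisms_def)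
qed

end

section \<open>Skew group algebras as algebras of functions\<close>

text \<open>A function \<open>f\<close> stands for the formal sum of the elements
  \<open>f t \<otimes> t\<close>. The product collects the terms with \<open>t s = u\<close>; the
  second index is eliminated as \<open>s = inv t \<otimes> u\<close>, leaving one sum over the
  group.\<close>

definition skew_function_algebra ::
  "('g, 'h) monoid_scheme \<Rightarrow> ('k, 'a, 'x) module_scheme \<Rightarrow> ('g \<Rightarrow> 'a \<Rightarrow> 'a) \<Rightarrow> ('k, 'g \<Rightarrow> 'a) module"
  where "skew_function_algebra G A \<alpha> =
    (direct_sum (carrier G) (\<lambda>_. A))
      \<lparr>monoid.mult := (\<lambda>f g. \<lambda>u\<in>carrier G. \<Oplus>\<^bsub>A\<^esub>t\<in>carrier G. f t \<otimes>\<^bsub>A\<^esub> \<alpha> t (g (inv\<^bsub>G\<^esub> t \<otimes>\<^bsub>G\<^esub> u))),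
       one := (\<lambda>s\<in>carrier G. if s = \<one>\<^bsub>G\<^esub> then \<one>\<^bsub>A\<^esub> else \<zero>\<^bsub>A\<^esub>)\<rparr>"

text \<open>The function that stands for \<open>a \<otimes> t\<close>.\<close>

definition skew_single ::
  "('g, 'h) monoid_scheme \<Rightarrow> ('k, 'a, 'x) module_scheme \<Rightarrow> 'g \<Rightarrow> 'a \<Rightarrow> 'g \<Rightarrow> 'a"
  where "skew_single G A t a = (\<lambda>s\<in>carrier G. if s = t then a else \<zero>\<^bsub>A\<^esub>)"

lemma carrier_skew_function_algebra:
  "carrier (skew_function_algebra G A \<alpha>) = carrier (direct_sum (carrier G) (\<lambda>_. A))"
  by (simp add: skew_function_algebra_def)

lemma skew_function_algebra_closed:
  "\<lbrakk>f \<in> carrier (skew_function_algebra G A \<alpha>); s \<in> carrier G\<rbrakk> \<Longrightarrow> f s \<in> carrier A"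
  using direct_sum_closed by (fastforce simp: carrier_skew_function_algebra)

lemma skew_function_algebra_memI:
  "\<lbrakk>f \<in> extensional (carrier G); \<And>s. s \<in> carrier G \<Longrightarrow> f s \<in> carrier A; finite (carrier G)\<rbrakk> \<Longrightarrow>
    f \<in> carrier (skew_function_algebra G A \<alpha>)"
  by (auto simp: carrier_skew_function_algebra intro!: direct_sum_memI)

lemma skew_function_algebra_ext:
  assumes "f \<in> carrier (skew_function_algebra G A \<alpha>)" "g \<in> carrier (skew_function_algebra G A \<alpha>)"
    and "\<And>s. s \<in> carrier G \<Longrightarrow> f s = g s"
  shows "f = g"
  using assms by (auto simp: carrier_skew_function_algebra intro: direct_sum_ext)

lemma skew_function_algebra_apply:
  assumes "u \<in> carrier G"
  shows "(f \<otimes>\<^bsub>skew_function_algebra G A \<alpha>\<^esub> g) u =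
      (\<Oplus>\<^bsub>A\<^esub>t\<in>carrier G. f t \<otimes>\<^bsub>A\<^esub> \<alpha> t (g (inv\<^bsub>G\<^esub> t \<otimes>\<^bsub>G\<^esub> u)))"
    and "\<one>\<^bsub>skew_function_algebra G A \<alpha>\<^esub> u = (if u = \<one>\<^bsub>G\<^esub> then \<one>\<^bsub>A\<^esub> else \<zero>\<^bsub>A\<^esub>)"
    and "(f \<oplus>\<^bsub>skew_function_algebra G A \<alpha>\<^esub> g) u = f u \<oplus>\<^bsub>A\<^esub> g u"
    and "\<zero>\<^bsub>skew_function_algebra G A \<alpha>\<^esub> u = \<zero>\<^bsub>A\<^esub>"
    and "(a \<odot>\<^bsub>skew_function_algebra G A \<alpha>\<^esub> f) u = a \<odot>\<^bsub>A\<^esub> f u"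
  using assms by (auto simp: skew_function_algebra_def direct_sum_apply)

lemma skew_function_algebra_extensional:
  "f \<otimes>\<^bsub>skew_function_algebra G A \<alpha>\<^esub> g \<in> extensional (carrier G)"
  "\<one>\<^bsub>skew_function_algebra G A \<alpha>\<^esub> \<in> extensional (carrier G)"
  by (simp_all add: skew_function_algebra_def)

lemma one_skew_function_algebra:
  "\<one>\<^bsub>skew_function_algebra G A \<alpha>\<^esub> = skew_single G A \<one>\<^bsub>G\<^esub> \<one>\<^bsub>A\<^esub>"
  by (simp add: skew_function_algebra_def skew_single_def)

lemma (in group) bij_betw_mult_left:
  assumes "t \<in> carrier G"
  shows "bij_betw (\<lambda>w. t \<otimes> w) (carrier G) (carrier G)"
  using assms
  by (intro bij_betw_byWitness[where f' = "\<lambda>w. inv t \<otimes> w"]) (auto simp flip: m_assoc)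

section \<open>The twisted convolution algebra\<close>

locale finite_group_acting_on_algebra =
  fixes k :: "('k, 'r) ring_scheme" and G :: "('g, 'h) monoid_scheme"
    and A :: "('k, 'a, 'x) module_scheme" and \<alpha> :: "'g \<Rightarrow> 'a \<Rightarrow> 'a"
  assumes acts: "acts_by_algebra_automorphisms k G A \<alpha>"
    and finite_G: "finite (carrier G)"
begin

sublocale A: associative_algebra k A
  using acts by (simp add: acts_by_algebra_automorphisms_def)

sublocale action: group_action G "carrier A" \<alpha>
  using acts by (simp add: acts_by_algebra_automorphisms_def)

sublocale G: group G
  using action.group_hom by (rule group_hom.axioms)

abbreviation S :: "('k, 'g \<Rightarrow> 'a) module"
  where "S \<equiv> skew_function_algebra G A \<alpha>"

lemma act_linear: "s \<in> carrier G \<Longrightarrow> linear_map k A A (\<alpha> s)"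
  using acts by (auto simp: acts_by_algebra_automorphisms_def algebra_iso_def)

lemma act_ring_hom: "s \<in> carrier G \<Longrightarrow> \<alpha> s \<in> ring_hom A A"
  using acts by (auto simp: acts_by_algebra_automorphisms_def algebra_iso_def ring_iso_def)

lemma act_closed [simp]: "\<lbrakk>s \<in> carrier G; a \<in> carrier A\<rbrakk> \<Longrightarrow> \<alpha> s a \<in> carrier A"
  using act_ring_hom ring_hom_closed by metis

lemma act_mult:
  "\<lbrakk>s \<in> carrier G; a \<in> carrier A; b \<in> carrier A\<rbrakk> \<Longrightarrow> \<alpha> s (a \<otimes>\<^bsub>A\<^esub> b) = \<alpha> s a \<otimes>\<^bsub>A\<^esub> \<alpha> s b"
  using act_ring_hom ring_hom_mult by metis

lemma act_one [simp]: "s \<in> carrier G \<Longrightarrow> \<alpha> s \<one>\<^bsub>A\<^esub> = \<one>\<^bsub>A\<^esub>"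
  using act_ring_hom ring_hom_one by metis

lemma act_zero [simp]: "s \<in> carrier G \<Longrightarrow> \<alpha> s \<zero>\<^bsub>A\<^esub> = \<zero>\<^bsub>A\<^esub>"
  using linear_map_zero[OF act_linear] A.M.abelian_group_axioms by blast

lemma act_group_one [simp]: "a \<in> carrier A \<Longrightarrow> \<alpha> \<one>\<^bsub>G\<^esub> a = a"
  by (metis action.id_eq_one restrict_apply')

lemma module_S: "module k S"
  unfolding skew_function_algebra_def
  by (simp add: module_direct_sum A.R.is_cring A.module_axioms)

lemma S_mult_closed: "\<lbrakk>f \<in> carrier S; g \<in> carrier S\<rbrakk> \<Longrightarrow> f \<otimes>\<^bsub>S\<^esub> g \<in> carrier S"
  by (intro skew_function_algebra_memI skew_function_algebra_extensional finite_G)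
    (auto simp: skew_function_algebra_apply skew_function_algebra_closed intro!: A.M.finsum_closed)

lemma S_mult_bilinear: "bilinear_map k S S S (monoid.mult S)"
  unfolding bilinear_map_def
proof (intro conjI ballI linear_mapI S_mult_closed)
  interpret S: module k S by (rule module_S)
  note ap = skew_function_algebra_apply and cl = skew_function_algebra_closed
  {
    fix f g h assume H: "f \<in> carrier S" "g \<in> carrier S" "h \<in> carrier S"
    show "f \<otimes>\<^bsub>S\<^esub> (g \<oplus>\<^bsub>S\<^esub> h) = f \<otimes>\<^bsub>S\<^esub> g \<oplus>\<^bsub>S\<^esub> f \<otimes>\<^bsub>S\<^esub> h"
      using H
      by (intro skew_function_algebra_ext[of _ G A \<alpha>] S_mult_closed S.M.a_closed)
        (auto simp: ap cl Pi_iff linear_map_add[OF act_linear] A.r_distr simp flip: A.M.finsum_addf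
          intro!: A.M.finsum_cong')
    show "(g \<oplus>\<^bsub>S\<^esub> h) \<otimes>\<^bsub>S\<^esub> f = g \<otimes>\<^bsub>S\<^esub> f \<oplus>\<^bsub>S\<^esub> h \<otimes>\<^bsub>S\<^esub> f"
      using H
      by (intro skew_function_algebra_ext[of _ G A \<alpha>] S_mult_closed S.M.a_closed)
        (auto simp: ap cl Pi_iff A.l_distr simp flip: A.M.finsum_addf intro!: A.M.finsum_cong')
  next
    fix a f g assume H: "a \<in> carrier k" "f \<in> carrier S" "g \<in> carrier S"
    show "f \<otimes>\<^bsub>S\<^esub> (a \<odot>\<^bsub>S\<^esub> g) = a \<odot>\<^bsub>S\<^esub> (f \<otimes>\<^bsub>S\<^esub> g)"
      using H finite_G
      by (intro skew_function_algebra_ext[of _ G A \<alpha>] S_mult_closed S.smult_closed)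
        (auto simp: ap cl Pi_iff linear_map_smult[OF act_linear] A.smult_mult_right A.finsum_smult_ldistr
          intro!: A.M.finsum_cong')
    show "(a \<odot>\<^bsub>S\<^esub> g) \<otimes>\<^bsub>S\<^esub> f = a \<odot>\<^bsub>S\<^esub> (g \<otimes>\<^bsub>S\<^esub> f)"
      using H finite_G
      by (intro skew_function_algebra_ext[of _ G A \<alpha>] S_mult_closed S.smult_closed)
        (auto simp: ap cl Pi_iff A.smult_mult_left A.finsum_smult_ldistr intro!: A.M.finsum_cong')
  }
qed

text \<open>Both sides become the same double sum after the sums are exchanged and
  \<open>v = t w\<close> is substituted for fixed \<open>t\<close>. The terms then match because
  \<open>\<alpha> t\<close> is multiplicative and \<open>\<alpha> (t w)\<close> is
  \<open>\<alpha> t\<close> after \<open>\<alpha> w\<close>.\<close>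

lemma S_mult_assoc:
  assumes H: "f \<in> carrier S" "g \<in> carrier S" "h \<in> carrier S"
  shows "f \<otimes>\<^bsub>S\<^esub> g \<otimes>\<^bsub>S\<^esub> h = f \<otimes>\<^bsub>S\<^esub> (g \<otimes>\<^bsub>S\<^esub> h)"
proof (intro skew_function_algebra_ext[of _ G A \<alpha>] S_mult_closed H)
  note ap = skew_function_algebra_apply and cl = H[THEN skew_function_algebra_closed]
  note L = bilinear_map_left[OF A.mult_bilinear] and R = bilinear_map_right[OF A.mult_bilinear]
  note lf = linear_map_finsum[OF _ A.M.abelian_group_axioms A.M.abelian_group_axioms]
  fix u assume u: "u \<in> carrier G"
  let ?t = "\<lambda>t v. f t \<otimes>\<^bsub>A\<^esub> \<alpha> t (g (inv\<^bsub>G\<^esub> t \<otimes>\<^bsub>G\<^esub> v)) \<otimes>\<^bsub>A\<^esub> \<alpha> v (h (inv\<^bsub>G\<^esub> v \<otimes>\<^bsub>G\<^esub> u))"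
  have "(f \<otimes>\<^bsub>S\<^esub> g \<otimes>\<^bsub>S\<^esub> h) u = (\<Oplus>\<^bsub>A\<^esub>v\<in>carrier G. \<Oplus>\<^bsub>A\<^esub>t\<in>carrier G. ?t t v)"
    using u by (auto simp: ap cl lf[OF L] Pi_iff intro!: A.M.finsum_cong' A.M.finsum_closed)
  also have "\<dots> = (\<Oplus>\<^bsub>A\<^esub>t\<in>carrier G. \<Oplus>\<^bsub>A\<^esub>v\<in>carrier G. ?t t v)"
    using u by (intro A.M.finsum_swap finite_G) (auto simp: cl)
  also have "\<dots> = (\<Oplus>\<^bsub>A\<^esub>t\<in>carrier G. f t \<otimes>\<^bsub>A\<^esub> \<alpha> t ((g \<otimes>\<^bsub>S\<^esub> h) (inv\<^bsub>G\<^esub> t \<otimes>\<^bsub>G\<^esub> u)))"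
  proof (rule A.M.finsum_cong'[OF refl])
    fix t assume t: "t \<in> carrier G"
    \<comment> \<open>Left translation by \<open>t\<close> permutes the group.\<close>
    have "(\<Oplus>\<^bsub>A\<^esub>v\<in>carrier G. ?t t v) = (\<Oplus>\<^bsub>A\<^esub>w\<in>carrier G. ?t t (t \<otimes>\<^bsub>G\<^esub> w))"
      using u t by (intro A.M.finsum_bij_betw[OF G.bij_betw_mult_left[OF t]]) (auto simp: cl)
    also have "\<dots> = (\<Oplus>\<^bsub>A\<^esub>w\<in>carrier G.
        f t \<otimes>\<^bsub>A\<^esub> \<alpha> t (g w \<otimes>\<^bsub>A\<^esub> \<alpha> w (h (inv\<^bsub>G\<^esub> w \<otimes>\<^bsub>G\<^esub> (inv\<^bsub>G\<^esub> t \<otimes>\<^bsub>G\<^esub> u)))))"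
    proof (rule A.M.finsum_cong'[OF refl])
      fix w assume w: "w \<in> carrier G"
      have "inv\<^bsub>G\<^esub> t \<otimes>\<^bsub>G\<^esub> (t \<otimes>\<^bsub>G\<^esub> w) = w"
        using t w by (simp flip: G.m_assoc)
      moreover have "inv\<^bsub>G\<^esub> (t \<otimes>\<^bsub>G\<^esub> w) \<otimes>\<^bsub>G\<^esub> u = inv\<^bsub>G\<^esub> w \<otimes>\<^bsub>G\<^esub> (inv\<^bsub>G\<^esub> t \<otimes>\<^bsub>G\<^esub> u)"
        using t u w by (simp add: G.inv_mult_group G.m_assoc)
      ultimately show "?t t (t \<otimes>\<^bsub>G\<^esub> w) =
          f t \<otimes>\<^bsub>A\<^esub> \<alpha> t (g w \<otimes>\<^bsub>A\<^esub> \<alpha> w (h (inv\<^bsub>G\<^esub> w \<otimes>\<^bsub>G\<^esub> (inv\<^bsub>G\<^esub> t \<otimes>\<^bsub>G\<^esub> u))))"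
        using t u w by (simp add: cl act_mult A.m_assoc action.composition_rule)
    qed (use t u in \<open>auto simp: cl\<close>)
    also have "\<dots> = f t \<otimes>\<^bsub>A\<^esub> \<alpha> t ((g \<otimes>\<^bsub>S\<^esub> h) (inv\<^bsub>G\<^esub> t \<otimes>\<^bsub>G\<^esub> u))"
      using t u by (simp add: ap cl lf[OF R] lf[OF act_linear] Pi_iff)
    finally show "(\<Oplus>\<^bsub>A\<^esub>v\<in>carrier G. ?t t v) = f t \<otimes>\<^bsub>A\<^esub> \<alpha> t ((g \<otimes>\<^bsub>S\<^esub> h) (inv\<^bsub>G\<^esub> t \<otimes>\<^bsub>G\<^esub> u))" .
  next
    show "(\<lambda>t. f t \<otimes>\<^bsub>A\<^esub> \<alpha> t ((g \<otimes>\<^bsub>S\<^esub> h) (inv\<^bsub>G\<^esub> t \<otimes>\<^bsub>G\<^esub> u))) \<in> carrier G \<rightarrow> carrier A"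
      using u skew_function_algebra_closed[OF S_mult_closed[OF H(2,3)]] by (auto simp: cl)
  qed
  also have "\<dots> = (f \<otimes>\<^bsub>S\<^esub> (g \<otimes>\<^bsub>S\<^esub> h)) u"
    using u by (simp add: ap(1))
  finally show "(f \<otimes>\<^bsub>S\<^esub> g \<otimes>\<^bsub>S\<^esub> h) u = (f \<otimes>\<^bsub>S\<^esub> (g \<otimes>\<^bsub>S\<^esub> h)) u" .
qed

lemma skew_single_closed: "a \<in> carrier A \<Longrightarrow> skew_single G A t a \<in> carrier S"
  by (intro skew_function_algebra_memI finite_G) (auto simp: skew_single_def)

lemma S_associative: "associative_algebra k S"
proof (rule associative_algebraI[OF module_S S_mult_bilinear])
  note ap = skew_function_algebra_apply and cl = skew_function_algebra_closed
  show one: "\<one>\<^bsub>S\<^esub> \<in> carrier S"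
    unfolding one_skew_function_algebra by (rule skew_single_closed) simp
  fix f assume f: "f \<in> carrier S"
  show "\<one>\<^bsub>S\<^esub> \<otimes>\<^bsub>S\<^esub> f = f"
  proof (intro skew_function_algebra_ext[of _ G A \<alpha>] S_mult_closed one f)
    fix u assume u: "u \<in> carrier G"
    show "(\<one>\<^bsub>S\<^esub> \<otimes>\<^bsub>S\<^esub> f) u = f u"
      unfolding ap(1)[OF u]
      by (rule A.M.finsum_delta[where i = "\<one>\<^bsub>G\<^esub>"]) (use f u in \<open>auto simp: ap cl finite_G\<close>)
  qed
  show "f \<otimes>\<^bsub>S\<^esub> \<one>\<^bsub>S\<^esub> = f"
  proof (intro skew_function_algebra_ext[of _ G A \<alpha>] S_mult_closed one f)
    fix u assume u: "u \<in> carrier G"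
    \<comment> \<open>The unit is supported at the neutral element, so only the summand with
      \<open>t = u\<close> survives.\<close>
    have "inv\<^bsub>G\<^esub> t \<otimes>\<^bsub>G\<^esub> u = \<one>\<^bsub>G\<^esub> \<longleftrightarrow> t = u" if "t \<in> carrier G" for t
      using u that G.inv_equality G.inv_inv G.l_inv by (metis G.inv_closed)
    with f u show "(f \<otimes>\<^bsub>S\<^esub> \<one>\<^bsub>S\<^esub>) u = f u"
      unfolding ap(1)[OF u]
      by (intro A.M.finsum_delta[where i = u]) (auto simp: ap cl finite_G)
  qed
qed (rule S_mult_assoc)

sublocale S: associative_algebra k S
  by (rule S_associative)

text \<open>This is the rule that prescribes the product of a skew group algebra, verified for
  convolution: at \<open>u\<close> only the summand at \<open>t\<close> can be nonzero, and it is so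
  only for \<open>u = t s\<close>.\<close>

lemma skew_single_mult:
  assumes "t \<in> carrier G" "s \<in> carrier G" "a \<in> carrier A" "b \<in> carrier A"
  shows "skew_single G A t a \<otimes>\<^bsub>S\<^esub> skew_single G A s b = skew_single G A (t \<otimes>\<^bsub>G\<^esub> s) (a \<otimes>\<^bsub>A\<^esub> \<alpha> t b)"
proof (intro skew_function_algebra_ext[of _ G A \<alpha>] S_mult_closed skew_single_closed)
  fix u assume u: "u \<in> carrier G"
  have "inv\<^bsub>G\<^esub> t \<otimes>\<^bsub>G\<^esub> u = s \<longleftrightarrow> u = t \<otimes>\<^bsub>G\<^esub> s"
    using u assms G.inv_solve_left by metis
  with assms u show "(skew_single G A t a \<otimes>\<^bsub>S\<^esub> skew_single G A s b) u =
      skew_single G A (t \<otimes>\<^bsub>G\<^esub> s) (a \<otimes>\<^bsub>A\<^esub> \<alpha> t b) u"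
    unfolding skew_function_algebra_apply(1)[OF u]
    by (intro A.M.finsum_delta[where i = t]) (auto simp: skew_single_def finite_G)
qed (use assms in auto)

lemma finsum_skew_single:
  assumes "f \<in> carrier S"
  shows "(\<Oplus>\<^bsub>S\<^esub>t\<in>carrier G. skew_single G A t (f t)) = f"
proof (rule skew_function_algebra_ext[OF _ assms])
  note cl = skew_function_algebra_closed[OF assms]
  show "(\<Oplus>\<^bsub>S\<^esub>t\<in>carrier G. skew_single G A t (f t)) \<in> carrier S"
    using cl by (intro S.M.finsum_closed) (auto intro: skew_single_closed)
  fix u assume u: "u \<in> carrier G"
  have "(\<Oplus>\<^bsub>S\<^esub>t\<in>carrier G. skew_single G A t (f t)) u = (\<Oplus>\<^bsub>A\<^esub>t\<in>carrier G. skew_single G A t (f t) u)"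
    using u cl
    by (intro linear_map_finsum[where h = "\<lambda>f. f u" and k = k] linear_mapI S.M.abelian_group_axioms
        A.M.abelian_group_axioms)
      (auto simp: skew_function_algebra_apply intro: skew_single_closed skew_function_algebra_closed)
  also have "\<dots> = f u"
    using u cl by (intro A.M.finsum_delta[where i = u]) (auto simp: skew_single_def finite_G)
  finally show "(\<Oplus>\<^bsub>S\<^esub>t\<in>carrier G. skew_single G A t (f t)) u = f u" .
qed

text \<open>Functions supported at one point span by \<open>finsum_skew_single\<close>. This reduces
  identities between linear maps on \<open>S\<close> to the elements that stand for
  \<open>a \<otimes> t\<close>.\<close>

lemma linear_map_eq_on_singles:
  assumes "linear_map k S P h" "linear_map k S P h'" "abelian_group P" "f \<in> carrier S"
    and "\<And>t a. \<lbrakk>t \<in> carrier G; a \<in> carrier A\<rbrakk> \<Longrightarrow> h (skew_single G A t a) = h' (skew_single G A t a)"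
  shows "h f = h' f"
proof -
  interpret P: abelian_group P by fact
  note cl = skew_function_algebra_closed[OF assms(4)]
  note lf = linear_map_finsum[OF _ S.M.abelian_group_axioms assms(3)]
  have sc: "(\<lambda>t. skew_single G A t (f t)) \<in> carrier G \<rightarrow> carrier S"
    using cl by (auto intro: skew_single_closed)
  have "h (\<Oplus>\<^bsub>S\<^esub>t\<in>carrier G. skew_single G A t (f t)) = h' (\<Oplus>\<^bsub>S\<^esub>t\<in>carrier G. skew_single G A t (f t))"
    unfolding lf[OF assms(1) sc] lf[OF assms(2) sc]
    using sc cl by (intro P.finsum_cong') (auto simp: assms(5) intro!: linear_map_closed[OF assms(2)])
  then show ?thesis
    by (simp add: finsum_skew_single assms(4))
qed

end

section \<open>Tensor products\<close>

locale tensor_modules = M: module k M + N: module k N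
  for k :: "('k, 'r) ring_scheme" and M :: "('k, 'm, 'x) module_scheme"
    and N :: "('k, 'n, 'y) module_scheme"
begin

abbreviation F :: "('m \<times> 'n \<Rightarrow>\<^sub>0 int) monoid"
  where "F \<equiv> free_Abelian_group (carrier M \<times> carrier N)"

abbreviation K :: "('m \<times> 'n \<Rightarrow>\<^sub>0 int) set"
  where "K \<equiv> tensor_kernel k M N"

abbreviation T :: "('k, ('m \<times> 'n \<Rightarrow>\<^sub>0 int) set) module"
  where "T \<equiv> tensor_product k M N"

abbreviation cls :: "('m \<times> 'n \<Rightarrow>\<^sub>0 int) \<Rightarrow> ('m \<times> 'n \<Rightarrow>\<^sub>0 int) set"
  where "cls \<equiv> tensor_class k M N"

abbreviation tensor :: "'m \<Rightarrow> 'n \<Rightarrow> ('m \<times> 'n \<Rightarrow>\<^sub>0 int) set"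
  where "tensor \<equiv> pure_tensor k M N"

abbreviation scale :: "'k \<Rightarrow> ('m \<times> 'n \<Rightarrow>\<^sub>0 int) \<Rightarrow> ('m \<times> 'n \<Rightarrow>\<^sub>0 int)"
  where "scale a \<equiv> frag_extend (\<lambda>(m, n). frag_of (a \<odot>\<^bsub>M\<^esub> m, n))"

sublocale F: comm_group F
  by (rule abelian_free_Abelian_group)

lemma F_diff: "\<lbrakk>c \<in> carrier F; d \<in> carrier F\<rbrakk> \<Longrightarrow> c - d \<in> carrier F"
  using keys_diff by fastforce

lemma F_add: "\<lbrakk>c \<in> carrier F; d \<in> carrier F\<rbrakk> \<Longrightarrow> c + d \<in> carrier F"
  using F.m_closed by simp

lemma F_of: "\<lbrakk>m \<in> carrier M; n \<in> carrier N\<rbrakk> \<Longrightarrow> frag_of (m, n) \<in> carrier F"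
  by simp

lemma tensor_relations_subset: "tensor_relations k M N \<subseteq> carrier F"
  unfolding tensor_relations_def
  by (auto simp del: carrier_free_Abelian_group_iff intro!: F_diff F_of)

lemma K_subgroup: "subgroup K F"
  unfolding tensor_kernel_def by (rule F.generate_is_subgroup[OF tensor_relations_subset])

lemma K_normal: "K \<lhd> F"
  using K_subgroup by (rule F.subgroup_imp_normal)

lemma relation_in_K: "c \<in> tensor_relations k M N \<Longrightarrow> c \<in> K"
  unfolding tensor_kernel_def by (rule generate.incl)

lemma K_add: "\<lbrakk>c \<in> K; d \<in> K\<rbrakk> \<Longrightarrow> c + d \<in> K"
  using subgroup.m_closed[OF K_subgroup] by simp

lemma K_minus: "c \<in> K \<Longrightarrow> - c \<in> K"
  using subgroup.m_inv_closed[OF K_subgroup, of c] subgroup.mem_carrier[OF K_subgroup, of c] by simp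

lemma T_simps:
  "carrier T = cls ` carrier F"
  "x \<oplus>\<^bsub>T\<^esub> y = x \<otimes>\<^bsub>F Mod K\<^esub> y"
  "\<zero>\<^bsub>T\<^esub> = K"
  by (simp_all add: tensor_product_def Let_def carrier_FactGroup tensor_class_def image_def)

lemma carrier_F_Mod_K: "carrier (F Mod K) = carrier T"
  by (simp add: tensor_product_def Let_def)

text \<open>Addition and zero of \<open>T\<close> are the product and unit of the quotient group
  \<open>F Mod K\<close>, so each law is read off from that group under other field names.\<close>

lemma T_abelian_group: "abelian_group T"
proof (rule abelian_groupI)
  interpret Q: comm_group "F Mod K"
    by (rule F.abelian_FactGroup[OF K_subgroup])
  note simps = T_simps(2) carrier_F_Mod_K[symmetric]
  have zero: "\<zero>\<^bsub>T\<^esub> = \<one>\<^bsub>F Mod K\<^esub>"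
    by (simp add: T_simps)
  show "x \<oplus>\<^bsub>T\<^esub> y \<in> carrier T" if "x \<in> carrier T" "y \<in> carrier T" for x y
    using that unfolding simps by (rule Q.m_closed)
  show "\<zero>\<^bsub>T\<^esub> \<in> carrier T"
    unfolding simps zero by (rule Q.one_closed)
  show "x \<oplus>\<^bsub>T\<^esub> y \<oplus>\<^bsub>T\<^esub> z = x \<oplus>\<^bsub>T\<^esub> (y \<oplus>\<^bsub>T\<^esub> z)"
    if "x \<in> carrier T" "y \<in> carrier T" "z \<in> carrier T" for x y z
    using that unfolding simps by (rule Q.m_assoc)
  show "x \<oplus>\<^bsub>T\<^esub> y = y \<oplus>\<^bsub>T\<^esub> x" if "x \<in> carrier T" "y \<in> carrier T" for x y
    using that unfolding simps by (rule Q.m_comm)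
  show "\<zero>\<^bsub>T\<^esub> \<oplus>\<^bsub>T\<^esub> x = x" if "x \<in> carrier T" for x
    using that unfolding simps zero by (rule Q.l_one)
  show "\<exists>y\<in>carrier T. y \<oplus>\<^bsub>T\<^esub> x = \<zero>\<^bsub>T\<^esub>" if "x \<in> carrier T" for x
    using that unfolding simps zero by (rule Q.l_inv_ex)
qed

sublocale T: abelian_group T
  by (rule T_abelian_group)

lemma cls_closed: "c \<in> carrier F \<Longrightarrow> cls c \<in> carrier T"
  by (simp add: T_simps)

lemma cls_add: "\<lbrakk>c \<in> carrier F; d \<in> carrier F\<rbrakk> \<Longrightarrow> cls (c + d) = cls c \<oplus>\<^bsub>T\<^esub> cls d"
  using normal.rcos_sum[OF K_normal, of c d] T_simps(2) by (simp add: tensor_class_def)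

lemma cls_zero: "cls 0 = \<zero>\<^bsub>T\<^esub>"
  using F.coset_mult_one[of K] subgroup.subset[OF K_subgroup] by (simp add: tensor_class_def T_simps)

lemma cls_eqI: "\<lbrakk>c \<in> carrier F; d \<in> carrier F; c - d \<in> K\<rbrakk> \<Longrightarrow> cls c = cls d"
proof -
  assume cd: "c \<in> carrier F" "d \<in> carrier F" "c - d \<in> K"
  then have "c \<in> K #>\<^bsub>F\<^esub> d"
    using subgroup.rcos_module[OF K_subgroup F.group_axioms, of d c] by simp
  then show ?thesis
    unfolding tensor_class_def using F.repr_independence[OF _ cd(2) K_subgroup] by simp
qed

lemma T_cases:
  assumes "x \<in> carrier T"
  obtains c where "c \<in> carrier F" "x = cls c"
  using assms by (auto simp: T_simps)

lemma cls_diff: "\<lbrakk>c \<in> carrier F; d \<in> carrier F\<rbrakk> \<Longrightarrow> cls (c - d) \<oplus>\<^bsub>T\<^esub> cls d = cls c"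
  using cls_add[of "c - d" d] F_diff by simp

lemma scale_closed: "\<lbrakk>a \<in> carrier k; c \<in> carrier F\<rbrakk> \<Longrightarrow> scale a c \<in> carrier F"
proof -
  assume a: "a \<in> carrier k" and c: "c \<in> carrier F"
  from c have "Poly_Mapping.keys c \<subseteq> carrier M \<times> carrier N" by simp
  then show "scale a c \<in> carrier F"
  proof (induction c rule: free_Abelian_group_induct[consumes 1, case_names zero diff of])
    case (diff x y)
    then show ?case
      using F_diff[of "scale a x" "scale a y"] by (simp add: frag_extend_diff)
  qed (use a in auto)
qed

text \<open>Scaling the left factor sends each defining relation to one of the same family; for the
  third family this uses that \<open>k\<close> is commutative, to turn \<open>a b m\<close> into
  \<open>b a m\<close>. Additivity of \<open>scale a\<close> extends this to the generated subgroup,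
  which makes scalar multiplication independent of the representative.\<close>

lemma scale_in_K:
  assumes a: "a \<in> carrier k" and c: "c \<in> K"
  shows "scale a c \<in> K"
proof -
  have rel: "scale a h \<in> K" if "h \<in> tensor_relations k M N" for h
    using that unfolding tensor_relations_def
  proof (elim UnE CollectE exE conjE)
    fix m m' n
    assume h: "h = frag_of (m \<oplus>\<^bsub>M\<^esub> m', n) - frag_of (m, n) - frag_of (m', n)"
      and m: "m \<in> carrier M" "m' \<in> carrier M" "n \<in> carrier N"
    show "scale a h \<in> K"
      using a m unfolding h
      by (intro relation_in_K)
        (auto simp: frag_extend_diff tensor_relations_def M.smult_r_distr intro: M.smult_closed)
  next
    fix m n n'
    assume h: "h = frag_of (m, n \<oplus>\<^bsub>N\<^esub> n') - frag_of (m, n) - frag_of (m, n')"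
      and m: "m \<in> carrier M" "n \<in> carrier N" "n' \<in> carrier N"
    show "scale a h \<in> K"
      using a m unfolding h
      by (intro relation_in_K)
        (auto simp: frag_extend_diff tensor_relations_def intro: M.smult_closed)
  next
    fix b m n
    assume h: "h = frag_of (b \<odot>\<^bsub>M\<^esub> m, n) - frag_of (m, b \<odot>\<^bsub>N\<^esub> n)"
      and m: "b \<in> carrier k" "m \<in> carrier M" "n \<in> carrier N"
    have "a \<odot>\<^bsub>M\<^esub> (b \<odot>\<^bsub>M\<^esub> m) = b \<odot>\<^bsub>M\<^esub> (a \<odot>\<^bsub>M\<^esub> m)"
      using a m by (simp add: M.R.m_comm flip: M.smult_assoc1)
    then show "scale a h \<in> K"
      using a m unfolding h
      by (intro relation_in_K)
        (auto simp: frag_extend_diff tensor_relations_def intro: M.smult_closed)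
  qed
  show ?thesis
    using c unfolding tensor_kernel_def
  proof (induction rule: generate.induct)
    case one
    then show ?case using generate.one[of F] by simp
  next
    case (incl h)
    then show ?case using rel by (simp add: tensor_kernel_def)
  next
    case (inv h)
    then have "inv\<^bsub>F\<^esub> h = - h"
      using tensor_relations_subset by auto
    with inv show ?case
      using K_minus[OF rel] by (simp add: frag_extend_minus tensor_kernel_def)
  next
    case (eng h1 h2)
    then show ?case using K_add by (simp add: frag_extend_add tensor_kernel_def)
  qed
qed

lemma T_smult:
  assumes a: "a \<in> carrier k" and c: "c \<in> carrier F"
  shows "a \<odot>\<^bsub>T\<^esub> cls c = cls (scale a c)"
proof -
  have eq: "cls (scale a d) = cls (scale a c)" if d: "d \<in> cls c" for d
  proof (rule cls_eqI)
    have dF: "d \<in> carrier F"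
      using subgroup.elemrcos_carrier[OF K_subgroup F.group_axioms c] d by (simp add: tensor_class_def)
    have "d - c \<in> K"
      using d c dF subgroup.rcos_module[OF K_subgroup F.group_axioms, of c d]
      by (simp add: tensor_class_def)
    then show "scale a d - scale a c \<in> K"
      using scale_in_K[OF a] by (simp flip: frag_extend_diff)
    show "scale a d \<in> carrier F" "scale a c \<in> carrier F"
      using scale_closed a c dF by auto
  qed
  have "a \<odot>\<^bsub>T\<^esub> cls c = (\<Union>d\<in>cls c. cls (scale a d))"
    by (simp add: tensor_product_def Let_def)
  also have "\<dots> = (\<Union>d\<in>cls c. cls (scale a c))"
    by (rule SUP_cong[OF refl eq])
  \<comment> \<open>All sets in the union are equal, and the index set is nonempty because
    \<open>c\<close> lies in its own coset.\<close>
  also have "\<dots> = cls (scale a c)"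
    using F.rcos_self[OF c K_subgroup] by (auto simp: tensor_class_def)
  finally show ?thesis .
qed

text \<open>Homogeneity holds because \<open>scale a\<close> and \<open>scale b\<close> commute,
  which is commutativity of \<open>k\<close> on generators. The lemma lets scalars pass through
  finite sums in \<open>T\<close>.\<close>

lemma T_smult_linear:
  assumes a: "a \<in> carrier k"
  shows "linear_map k T T (\<lambda>x. a \<odot>\<^bsub>T\<^esub> x)"
proof (rule linear_mapI)
  show "a \<odot>\<^bsub>T\<^esub> x \<in> carrier T" if "x \<in> carrier T" for x
    using that
    by (elim T_cases) (simp only: T_smult[OF a] cls_closed scale_closed[OF a])
  show "a \<odot>\<^bsub>T\<^esub> (x \<oplus>\<^bsub>T\<^esub> y) = a \<odot>\<^bsub>T\<^esub> x \<oplus>\<^bsub>T\<^esub> a \<odot>\<^bsub>T\<^esub> y"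
    if x: "x \<in> carrier T" and y: "y \<in> carrier T" for x y
  proof -
    obtain c where c: "c \<in> carrier F" "x = cls c"
      using x by (rule T_cases)
    obtain d where d: "d \<in> carrier F" "y = cls d"
      using y by (rule T_cases)
    from c d show ?thesis
      using T_smult[OF a, of c] T_smult[OF a, of d] T_smult[OF a F_add, of c d]
        cls_add[of c d] cls_add[OF scale_closed[OF a] scale_closed[OF a], of c d]
      by (simp add: frag_extend_add del: carrier_free_Abelian_group_iff)
  qed
  show "a \<odot>\<^bsub>T\<^esub> (b \<odot>\<^bsub>T\<^esub> x) = b \<odot>\<^bsub>T\<^esub> (a \<odot>\<^bsub>T\<^esub> x)" if b: "b \<in> carrier k" and x: "x \<in> carrier T" for b x
  proof -
    obtain c where c: "c \<in> carrier F" "x = cls c"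
      using x by (rule T_cases)
    then have "Poly_Mapping.keys c \<subseteq> carrier M \<times> carrier N" by simp
    then have "scale a (scale b c) = scale b (scale a c)"
    proof (induction c rule: free_Abelian_group_induct[consumes 1, case_names zero diff of])
      case (diff c d)
      then show ?case by (simp add: frag_extend_diff)
    next
      case (of p)
      then show ?case
        using a b M.R.m_comm[of a b] by (auto simp flip: M.smult_assoc1)
    qed simp
    with c show ?thesis
      by (simp add: T_smult a b scale_closed del: carrier_free_Abelian_group_iff)
  qed
qed

lemmas T_smult_closed = linear_map_closed[OF T_smult_linear]

lemma tensor_closed: "\<lbrakk>m \<in> carrier M; n \<in> carrier N\<rbrakk> \<Longrightarrow> tensor m n \<in> carrier T"
  unfolding pure_tensor_def by (intro cls_closed F_of)

lemma tensor_bilinear: "bilinear_map k M N T tensor"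
  unfolding bilinear_map_def
proof (intro conjI ballI linear_mapI tensor_closed)
  fix m n n' assume H: "m \<in> carrier M" "n \<in> carrier N" "n' \<in> carrier N"
  \<comment> \<open>The relation is regrouped as one difference, the form that
    \<open>cls_eqI\<close> compares.\<close>
  have "frag_of (m, n \<oplus>\<^bsub>N\<^esub> n') - (frag_of (m, n) + frag_of (m, n')) \<in> K"
    using H by (intro relation_in_K) (auto simp: tensor_relations_def diff_diff_eq)
  then show "tensor m (n \<oplus>\<^bsub>N\<^esub> n') = tensor m n \<oplus>\<^bsub>T\<^esub> tensor m n'"
    using H unfolding pure_tensor_def
    by (subst cls_add[symmetric]) (simp_all only: F_of cls_eqI F_add N.M.a_closed M.M.a_closed)
next
  fix n m m' assume H: "n \<in> carrier N" "m \<in> carrier M" "m' \<in> carrier M"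
  have "frag_of (m \<oplus>\<^bsub>M\<^esub> m', n) - (frag_of (m, n) + frag_of (m', n)) \<in> K"
    using H by (intro relation_in_K) (auto simp: tensor_relations_def diff_diff_eq)
  then show "tensor (m \<oplus>\<^bsub>M\<^esub> m') n = tensor m n \<oplus>\<^bsub>T\<^esub> tensor m' n"
    using H unfolding pure_tensor_def
    by (subst cls_add[symmetric]) (simp_all only: F_of cls_eqI F_add N.M.a_closed M.M.a_closed)
next
  fix n a m assume H: "n \<in> carrier N" "a \<in> carrier k" "m \<in> carrier M"
  then show "tensor (a \<odot>\<^bsub>M\<^esub> m) n = a \<odot>\<^bsub>T\<^esub> tensor m n"
    by (simp add: pure_tensor_def T_smult)
next
  fix m a n assume H: "m \<in> carrier M" "a \<in> carrier k" "n \<in> carrier N"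
  \<comment> \<open>Scalar multiplication of \<open>T\<close> acts on the left factor by definition;
    the third family of relations carries the scalar over to the right one.\<close>
  have "frag_of (a \<odot>\<^bsub>M\<^esub> m, n) - frag_of (m, a \<odot>\<^bsub>N\<^esub> n) \<in> K"
    using H by (intro relation_in_K) (auto simp: tensor_relations_def)
  then have "tensor (a \<odot>\<^bsub>M\<^esub> m) n = tensor m (a \<odot>\<^bsub>N\<^esub> n)"
    using H unfolding pure_tensor_def by (intro cls_eqI) auto
  then show "tensor m (a \<odot>\<^bsub>N\<^esub> n) = a \<odot>\<^bsub>T\<^esub> tensor m n"
    using H by (simp add: pure_tensor_def T_smult)
qed auto

lemma linear_map_eq_on_tensors:
  assumes "linear_map k T P h" "linear_map k T P h'" "abelian_group P" "x \<in> carrier T"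
    and "\<And>m n. \<lbrakk>m \<in> carrier M; n \<in> carrier N\<rbrakk> \<Longrightarrow> h (tensor m n) = h' (tensor m n)"
  shows "h x = h' x"
proof -
  interpret P: abelian_group P by fact
  obtain c where c: "c \<in> carrier F" "x = cls c"
    using assms(4) by (rule T_cases)
  then have "Poly_Mapping.keys c \<subseteq> carrier M \<times> carrier N" by simp
  then have "h (cls c) = h' (cls c)"
  proof (induction c rule: free_Abelian_group_induct[consumes 1, case_names zero diff of])
    case zero
    show ?case
      using linear_map_zero[OF assms(1) T_abelian_group assms(3)]
        linear_map_zero[OF assms(2) T_abelian_group assms(3)] by (simp add: cls_zero)
  next
    case (diff c d)
    then have cd: "cls (c - d) \<in> carrier T" "cls d \<in> carrier T"
      using cls_closed F_diff by auto
    \<comment> \<open>Both sides are the images of \<open>cls c\<close>, on which \<open>h\<close>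
      and \<open>h'\<close> agree by induction; the summand at \<open>d\<close> is then
      cancelled.\<close>
    have "h (cls (c - d)) \<oplus>\<^bsub>P\<^esub> h (cls d) = h' (cls (c - d)) \<oplus>\<^bsub>P\<^esub> h' (cls d)"
      using diff cls_diff[of c d] linear_map_add[OF assms(1) cd] linear_map_add[OF assms(2) cd] by simp
    with diff show ?case
      using cd by (simp add: linear_map_closed[OF assms(1)] linear_map_closed[OF assms(2)])
  next
    case (of p)
    then show ?case
      using assms(5)[of "fst p" "snd p"] by (auto simp: pure_tensor_def)
  qed
  with c show ?thesis by simp
qed

text \<open>The universal property: \<open>b\<close> extends additively to the free abelian group,
  the extension kills the relations by bilinearity, and hence it factors through the
  quotient.\<close>

lemma tensor_lift:
  assumes b: "bilinear_map k M N P b" and P: "module k P"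
  obtains \<phi> where "linear_map k T P \<phi>"
    and "\<And>m n. \<lbrakk>m \<in> carrier M; n \<in> carrier N\<rbrakk> \<Longrightarrow> \<phi> (tensor m n) = b m n"
proof -
  interpret P: module k P by fact
  note L = bilinear_map_left[OF b] and R = bilinear_map_right[OF b]
  have "case_prod b ` (carrier M \<times> carrier N) \<subseteq> carrier (add_monoid P)"
    using bilinear_map_closed[OF b] by auto
  then obtain h where h: "h \<in> hom F (add_monoid P)"
    and hb: "\<And>p. p \<in> carrier M \<times> carrier N \<Longrightarrow> h (frag_of p) = case_prod b p"
    using comm_group.free_Abelian_group_universal[OF P.M.a_comm_group] by blast
  interpret h: group_hom F "add_monoid P" h
    using h F.group_axioms P.M.a_group by (intro group_hom.intro group_hom_axioms.intro)
  have hc: "h c \<in> carrier P" if "c \<in> carrier F" for c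
    using h.hom_closed[OF that] by simp
  \<comment> \<open>Differences are handled in this proof by adding the subtrahend back and
    cancelling in \<open>P\<close>.\<close>
  have hd: "h (c - d) \<oplus>\<^bsub>P\<^esub> h d = h c" if "c \<in> carrier F" "d \<in> carrier F" for c d
    using h.hom_mult[OF F_diff[OF that] that(2)] by simp
  have "tensor_relations k M N \<subseteq> kernel F (add_monoid P) h"
  proof
    fix c assume c: "c \<in> tensor_relations k M N"
    then have cF: "c \<in> carrier F"
      using tensor_relations_subset by blast
    from c have "h c = \<zero>\<^bsub>P\<^esub>"
      unfolding tensor_relations_def
    proof (elim UnE CollectE exE conjE)
      fix m m' n
      assume c: "c = frag_of (m \<oplus>\<^bsub>M\<^esub> m', n) - frag_of (m, n) - frag_of (m', n)"
        and m: "m \<in> carrier M" "m' \<in> carrier M" "n \<in> carrier N"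
      have "h c \<oplus>\<^bsub>P\<^esub> (b m n \<oplus>\<^bsub>P\<^esub> b m' n) = h (c + (frag_of (m, n) + frag_of (m', n)))"
        using h.hom_mult[OF cF F_add[OF F_of[of m n] F_of[of m' n]]]
          h.hom_mult[OF F_of[of m n] F_of[of m' n]] m by (simp add: hb)
      also have "\<dots> = b m n \<oplus>\<^bsub>P\<^esub> b m' n"
        using m by (simp add: c hb linear_map_add[OF L])
      finally show ?thesis
        using m hc[OF cF] bilinear_map_closed[OF b] P.M.add.r_cancel_one by auto
    next
      fix m n n'
      assume c: "c = frag_of (m, n \<oplus>\<^bsub>N\<^esub> n') - frag_of (m, n) - frag_of (m, n')"
        and m: "m \<in> carrier M" "n \<in> carrier N" "n' \<in> carrier N"
      have "h c \<oplus>\<^bsub>P\<^esub> (b m n \<oplus>\<^bsub>P\<^esub> b m n') = h (c + (frag_of (m, n) + frag_of (m, n')))"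
        using h.hom_mult[OF cF F_add[OF F_of[of m n] F_of[of m n']]]
          h.hom_mult[OF F_of[of m n] F_of[of m n']] m by (simp add: hb)
      also have "\<dots> = b m n \<oplus>\<^bsub>P\<^esub> b m n'"
        using m by (simp add: c hb linear_map_add[OF R])
      finally show ?thesis
        using m hc[OF cF] bilinear_map_closed[OF b] P.M.add.r_cancel_one by auto
    next
      fix a m n
      assume c: "c = frag_of (a \<odot>\<^bsub>M\<^esub> m, n) - frag_of (m, a \<odot>\<^bsub>N\<^esub> n)"
        and m: "a \<in> carrier k" "m \<in> carrier M" "n \<in> carrier N"
      have "h c \<oplus>\<^bsub>P\<^esub> a \<odot>\<^bsub>P\<^esub> b m n = a \<odot>\<^bsub>P\<^esub> b m n"
        using hd[OF F_of[of "a \<odot>\<^bsub>M\<^esub> m" n] F_of[of m "a \<odot>\<^bsub>N\<^esub> n"]] m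
        by (simp add: c hb linear_map_smult[OF L] linear_map_smult[OF R])
      then show ?thesis
        using m hc[OF cF] bilinear_map_closed[OF b] P.M.add.r_cancel_one by auto
    qed
    with cF show "c \<in> kernel F (add_monoid P) h"
      by (simp add: kernel_def)
  qed
  then have "K \<subseteq> kernel F (add_monoid P) h"
    unfolding tensor_kernel_def by (rule F.generate_subgroup_incl[OF _ h.subgroup_kernel])
  then obtain \<phi> where \<phi>: "\<phi> \<in> hom (F Mod K) (add_monoid P)"
    and "\<And>c. c \<in> carrier F \<Longrightarrow> \<phi> (K #>\<^bsub>F\<^esub> c) = h c"
    using h.FactGroup_universal_kernel[OF K_normal] by metis
  then have \<phi>h: "\<phi> (cls c) = h c" if "c \<in> carrier F" for c
    using that by (simp add: tensor_class_def)
  \<comment> \<open>The construction makes \<open>h\<close> only additive. Its compatibility with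
    scalars comes from linearity of \<open>b\<close> in the left argument, the one that
    \<open>scale\<close> acts on.\<close>
  have scale: "h (scale a c) = a \<odot>\<^bsub>P\<^esub> h c" if a: "a \<in> carrier k" and c: "c \<in> carrier F" for a c
  proof -
    from c have "Poly_Mapping.keys c \<subseteq> carrier M \<times> carrier N" by simp
    then show ?thesis
    proof (induction c rule: free_Abelian_group_induct[consumes 1, case_names zero diff of])
      case zero
      then show ?case using a h.hom_one by simp
    next
      case (diff c d)
      then have cd: "c \<in> carrier F" "d \<in> carrier F" by auto
      have "h (scale a (c - d)) \<oplus>\<^bsub>P\<^esub> h (scale a d) = h (scale a c)"
        using hd scale_closed[OF a] cd by (simp add: frag_extend_diff del: carrier_free_Abelian_group_iff)
      also have "\<dots> = a \<odot>\<^bsub>P\<^esub> h (c - d) \<oplus>\<^bsub>P\<^esub> h (scale a d)"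
        using diff a hc cd F_diff hd[OF cd]
        by (simp del: carrier_free_Abelian_group_iff flip: P.smult_r_distr)
      finally show ?case
        using P.M.add.r_cancel[of "h (scale a (c - d))" "h (scale a d)" "a \<odot>\<^bsub>P\<^esub> h (c - d)"]
          a hc[OF scale_closed[OF a]] hc[OF F_diff[OF cd]] F_diff[OF cd] cd(2)
        by (metis P.smult_closed)
    next
      case (of p)
      then show ?case
        using a by (auto simp: hb linear_map_smult[OF L])
    qed
  qed
  show thesis
  proof
    show "linear_map k T P \<phi>"
    proof (rule linear_mapI)
      show "\<phi> x \<in> carrier P" if "x \<in> carrier T" for x
        using that by (elim T_cases) (simp add: \<phi>h hc del: carrier_free_Abelian_group_iff)
      show "\<phi> (x \<oplus>\<^bsub>T\<^esub> y) = \<phi> x \<oplus>\<^bsub>P\<^esub> \<phi> y" if "x \<in> carrier T" "y \<in> carrier T" for x y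
        using hom_mult[OF \<phi>, of x y] that by (simp add: carrier_F_Mod_K T_simps(2))
      show "\<phi> (a \<odot>\<^bsub>T\<^esub> x) = a \<odot>\<^bsub>P\<^esub> \<phi> x" if "a \<in> carrier k" "x \<in> carrier T" for a x
        using that
        by (elim T_cases) (simp add: \<phi>h T_smult scale scale_closed del: carrier_free_Abelian_group_iff)
    qed
    show "\<phi> (tensor m n) = b m n" if "m \<in> carrier M" "n \<in> carrier N" for m n
      using that by (simp add: pure_tensor_def \<phi>h hb)
  qed
qed

end

section \<open>The skew group algebra\<close>

lemma module_regular_module: "cring k \<Longrightarrow> module k (regular_module k)"
proof -
  assume "cring k"
  then interpret cring k .
  have "abelian_group (regular_module k)"
    by (rule abelian_groupI) (auto simp: regular_module_def a_ac 
        intro: bexI[of _ "\<ominus>\<^bsub>k\<^esub> _"] l_neg)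
  then show ?thesis
    by (intro moduleI) (auto simp: regular_module_def is_cring l_distr r_distr m_assoc)
qed

section \<open>Identification of the tensor product with functions on the group\<close>

context finite_group_acting_on_algebra
begin

abbreviation kG :: "('k, 'g \<Rightarrow> 'k) module"
  where "kG \<equiv> group_module k G"

lemma module_group_module: "module k kG"
  unfolding group_module_def
  by (intro module_direct_sum module_regular_module A.R.is_cring)

sublocale tensor_modules k A kG
  by (intro tensor_modules.intro A.module_axioms module_group_module)

lemma group_module_closed: "\<lbrakk>n \<in> carrier kG; s \<in> carrier G\<rbrakk> \<Longrightarrow> n s \<in> carrier k"
  using direct_sum_closed[of n "carrier G" "\<lambda>_. regular_module k" s]
  by (simp add: group_module_def regular_module_def)

lemma group_module_apply:
  assumes "s \<in> carrier G"
  shows "(n \<oplus>\<^bsub>kG\<^esub> n') s = n s \<oplus>\<^bsub>k\<^esub> n' s" "(a \<odot>\<^bsub>kG\<^esub> n) s = a \<otimes>\<^bsub>k\<^esub> n s"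
  using assms by (simp_all add: group_module_def direct_sum_apply) (simp_all add: regular_module_def)

lemma group_basis_closed: "group_basis k G t \<in> carrier kG"
  unfolding group_module_def
  by (rule direct_sum_memI) (auto simp: group_basis_def regular_module_def finite_G)

text \<open>Expansion in the basis of group elements, compared pointwise: at \<open>u\<close> only
  the summand with \<open>s = u\<close> survives.\<close>

lemma finsum_group_basis:
  assumes n: "n \<in> carrier kG"
  shows "(\<Oplus>\<^bsub>kG\<^esub>s\<in>carrier G. n s \<odot>\<^bsub>kG\<^esub> group_basis k G s) = n"
proof -
  let ?R = "regular_module k"
  interpret N: module k kG by (rule module_group_module)
  interpret R: module k ?R by (rule module_regular_module[OF A.R.is_cring])
  let ?n = "\<lambda>s. n s \<odot>\<^bsub>kG\<^esub> group_basis k G s"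
  have cl: "?n \<in> carrier G \<rightarrow> carrier kG"
    using n by (auto intro!: N.smult_closed group_module_closed group_basis_closed)
  have "finsum kG ?n (carrier G) u = n u" if u: "u \<in> carrier G" for u
  proof -
    have "finsum kG ?n (carrier G) u = (\<Oplus>\<^bsub>?R\<^esub>s\<in>carrier G. ?n s u)"
      using u cl unfolding group_module_def
      by (intro finsum_direct_sum_apply[OF A.R.is_cring R.module_axioms]) auto
    also have "\<dots> = n u"
      using u n
      by (intro R.M.finsum_delta[where i = u])
        (auto simp: finite_G group_module_apply group_basis_def regular_module_def group_module_closed)
    finally show ?thesis .
  qed
  then show ?thesis
    using N.M.finsum_closed[OF cl] n
    unfolding group_module_def by (intro direct_sum_ext[of _ "carrier G" "\<lambda>_. ?R" _ "\<lambda>_. ?R"]) auto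
qed

text \<open>A map into the tensor product raises no question of well-definedness, so this direction
  can be written down directly.\<close>

definition from_function :: "('g \<Rightarrow> 'a) \<Rightarrow> ('a \<times> ('g \<Rightarrow> 'k) \<Rightarrow>\<^sub>0 int) set"
  where "from_function f = (\<Oplus>\<^bsub>T\<^esub>s\<in>carrier G. skew_tensor k G A (f s) s)"

lemma skew_tensor_linear: "linear_map k A T (\<lambda>a. skew_tensor k G A a t)"
  unfolding skew_tensor_def by (rule bilinear_map_left[OF tensor_bilinear group_basis_closed])

lemmas skew_tensor_closed = linear_map_closed[OF skew_tensor_linear]

lemma from_function_closed: "f \<in> carrier S \<Longrightarrow> from_function f \<in> carrier T"
  unfolding from_function_def
  by (intro T.finsum_closed) (auto simp: skew_tensor_closed skew_function_algebra_closed)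

lemma from_function_linear: "linear_map k S T from_function"
proof (rule linear_mapI[OF from_function_closed])
  note cl = skew_function_algebra_closed and ap = skew_function_algebra_apply
  show "from_function (f \<oplus>\<^bsub>S\<^esub> g) = from_function f \<oplus>\<^bsub>T\<^esub> from_function g"
    if "f \<in> carrier S" "g \<in> carrier S" for f g
  proof -
    have "from_function (f \<oplus>\<^bsub>S\<^esub> g) =
        (\<Oplus>\<^bsub>T\<^esub>s\<in>carrier G. skew_tensor k G A (f s) s \<oplus>\<^bsub>T\<^esub> skew_tensor k G A (g s) s)"
      unfolding from_function_def using that
      by (intro T.finsum_cong')
        (auto simp: ap linear_map_add[OF skew_tensor_linear] skew_tensor_closed cl)
    also have "\<dots> = from_function f \<oplus>\<^bsub>T\<^esub> from_function g"
      unfolding from_function_def using that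
      by (intro T.finsum_addf) (auto simp: skew_tensor_closed cl)
    finally show ?thesis .
  qed
  show "from_function (a \<odot>\<^bsub>S\<^esub> f) = a \<odot>\<^bsub>T\<^esub> from_function f" if "a \<in> carrier k" "f \<in> carrier S" for a f
  proof -
    have "a \<odot>\<^bsub>T\<^esub> from_function f = (\<Oplus>\<^bsub>T\<^esub>s\<in>carrier G. a \<odot>\<^bsub>T\<^esub> skew_tensor k G A (f s) s)"
      unfolding from_function_def using that
      by (intro linear_map_finsum[OF T_smult_linear T_abelian_group T_abelian_group])
        (auto simp: skew_tensor_closed cl)
    also have "\<dots> = from_function (a \<odot>\<^bsub>S\<^esub> f)"
      unfolding from_function_def using that
      by (intro T.finsum_cong')
        (auto simp: ap linear_map_smult[OF skew_tensor_linear] skew_tensor_closed cl T_smult_closed)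
    finally show ?thesis by simp
  qed
qed

lemma from_function_single:
  assumes "t \<in> carrier G" "a \<in> carrier A"
  shows "from_function (skew_single G A t a) = skew_tensor k G A a t"
  unfolding from_function_def
  using assms
  by (intro T.finsum_delta[where i = t])
    (auto simp: finite_G skew_single_def skew_tensor_closed
      linear_map_zero[OF skew_tensor_linear A.M.abelian_group_axioms T_abelian_group])

text \<open>Each scalar \<open>n s\<close> is moved from the left factor to the right one; the right
  factors then add up to the basis expansion of \<open>n\<close>. This shows that the map reaches
  every pure tensor.\<close>

lemma from_function_tensor:
  assumes m: "m \<in> carrier A" and n: "n \<in> carrier kG"
  shows "from_function (\<lambda>s\<in>carrier G. n s \<odot>\<^bsub>A\<^esub> m) = tensor m n"
proof -
  note b = tensor_bilinear and nc = group_module_closed[OF n]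
  note bc = bilinear_map_closed[OF b]
  have "from_function (\<lambda>s\<in>carrier G. n s \<odot>\<^bsub>A\<^esub> m) =
      (\<Oplus>\<^bsub>T\<^esub>s\<in>carrier G. tensor m (n s \<odot>\<^bsub>kG\<^esub> group_basis k G s))"
    unfolding from_function_def skew_tensor_def
    using m by (intro T.finsum_cong')
      (auto simp: nc linear_map_smult[OF bilinear_map_left[OF b]] linear_map_smult[OF bilinear_map_right[OF b]]
        group_basis_closed bc T_smult_closed)
  also have "\<dots> = tensor m (\<Oplus>\<^bsub>kG\<^esub>s\<in>carrier G. n s \<odot>\<^bsub>kG\<^esub> group_basis k G s)"
    by (rule linear_map_finsum[OF bilinear_map_right[OF b m] N.M.abelian_group_axioms T_abelian_group, symmetric])
      (auto simp: nc group_basis_closed N.smult_closed)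
  finally show ?thesis
    by (simp add: finsum_group_basis n)
qed

text \<open>The formula on pure tensors is bilinear in \<open>m\<close> and \<open>n\<close>, so the
  universal property extends it to the candidate for the inverse of
  \<open>from_function\<close>.\<close>

lemma to_function_exists:
  obtains \<psi> where "linear_map k T S \<psi>"
    and "\<And>m n. \<lbrakk>m \<in> carrier A; n \<in> carrier kG\<rbrakk> \<Longrightarrow> \<psi> (tensor m n) = (\<lambda>s\<in>carrier G. n s \<odot>\<^bsub>A\<^esub> m)"
proof -
  note ap = skew_function_algebra_apply
  have cl: "(\<lambda>s\<in>carrier G. n s \<odot>\<^bsub>A\<^esub> m) \<in> carrier S" if "m \<in> carrier A" "n \<in> carrier kG" for m n
    using that by (intro skew_function_algebra_memI finite_G) (auto simp: group_module_closed)
  have "bilinear_map k A kG S (\<lambda>m n. \<lambda>s\<in>carrier G. n s \<odot>\<^bsub>A\<^esub> m)"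
    unfolding bilinear_map_def
  proof (intro conjI ballI linear_mapI cl)
    fix m n n' assume "m \<in> carrier A" "n \<in> carrier kG" "n' \<in> carrier kG"
    then show "(\<lambda>s\<in>carrier G. (n \<oplus>\<^bsub>kG\<^esub> n') s \<odot>\<^bsub>A\<^esub> m) =
        (\<lambda>s\<in>carrier G. n s \<odot>\<^bsub>A\<^esub> m) \<oplus>\<^bsub>S\<^esub> (\<lambda>s\<in>carrier G. n' s \<odot>\<^bsub>A\<^esub> m)"
      by (intro skew_function_algebra_ext[of _ G A \<alpha>] cl S.M.a_closed N.M.a_closed)
        (auto simp: ap group_module_apply A.smult_l_distr group_module_closed)
  next
    fix m a n assume "m \<in> carrier A" "a \<in> carrier k" "n \<in> carrier kG"
    then show "(\<lambda>s\<in>carrier G. (a \<odot>\<^bsub>kG\<^esub> n) s \<odot>\<^bsub>A\<^esub> m) = a \<odot>\<^bsub>S\<^esub> (\<lambda>s\<in>carrier G. n s \<odot>\<^bsub>A\<^esub> m)"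
      by (intro skew_function_algebra_ext[of _ G A \<alpha>] cl S.smult_closed N.smult_closed)
        (auto simp: ap group_module_apply A.smult_assoc1 group_module_closed)
  next
    fix n m m' assume "n \<in> carrier kG" "m \<in> carrier A" "m' \<in> carrier A"
    then show "(\<lambda>s\<in>carrier G. n s \<odot>\<^bsub>A\<^esub> (m \<oplus>\<^bsub>A\<^esub> m')) =
        (\<lambda>s\<in>carrier G. n s \<odot>\<^bsub>A\<^esub> m) \<oplus>\<^bsub>S\<^esub> (\<lambda>s\<in>carrier G. n s \<odot>\<^bsub>A\<^esub> m')"
      by (intro skew_function_algebra_ext[of _ G A \<alpha>] cl S.M.a_closed A.M.a_closed)
        (auto simp: ap A.smult_r_distr group_module_closed)
  next
    fix n a m assume "n \<in> carrier kG" "a \<in> carrier k" "m \<in> carrier A"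
    then show "(\<lambda>s\<in>carrier G. n s \<odot>\<^bsub>A\<^esub> (a \<odot>\<^bsub>A\<^esub> m)) = a \<odot>\<^bsub>S\<^esub> (\<lambda>s\<in>carrier G. n s \<odot>\<^bsub>A\<^esub> m)"
      using A.R.m_comm[of a]
      by (intro skew_function_algebra_ext[of _ G A \<alpha>] cl S.smult_closed A.smult_closed)
        (auto simp: ap group_module_closed simp flip: A.smult_assoc1)
  qed auto
  then show thesis
    using module_S that by (rule tensor_lift)
qed

text \<open>Both composites with the map from \<open>to_function_exists\<close> are linear, so they
  need comparing with the identity only on generators: one-point functions in \<open>S\<close>, pure
  tensors in \<open>T\<close>.\<close>

lemma from_function_bij_betw: "bij_betw from_function (carrier S) (carrier T)"
proof -
  obtain \<psi> where \<psi>: "linear_map k T S \<psi>"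
    and \<psi>t: "\<And>m n. \<lbrakk>m \<in> carrier A; n \<in> carrier kG\<rbrakk> \<Longrightarrow> \<psi> (tensor m n) = (\<lambda>s\<in>carrier G. n s \<odot>\<^bsub>A\<^esub> m)"
    using to_function_exists by blast
  have left: "\<psi> (from_function f) = f" if "f \<in> carrier S" for f
  proof (rule linear_map_eq_on_singles[OF linear_map_comp[OF from_function_linear \<psi>] _ S.M.abelian_group_axioms that])
    show "linear_map k S S (\<lambda>f. f)" by (rule linear_mapI) simp_all
    fix t a assume "t \<in> carrier G" "a \<in> carrier A"
    then have "\<psi> (from_function (skew_single G A t a)) = (\<lambda>s\<in>carrier G. group_basis k G t s \<odot>\<^bsub>A\<^esub> a)"
      by (simp add: from_function_single skew_tensor_def \<psi>t group_basis_closed)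
    also have "\<dots> = skew_single G A t a"
      using \<open>a \<in> carrier A\<close> by (auto simp: group_basis_def skew_single_def)
    finally show "\<psi> (from_function (skew_single G A t a)) = skew_single G A t a" .
  qed
  have right: "from_function (\<psi> x) = x" if "x \<in> carrier T" for x
  proof (rule linear_map_eq_on_tensors[OF linear_map_comp[OF \<psi> from_function_linear] _ T_abelian_group that])
    show "linear_map k T T (\<lambda>x. x)" by (rule linear_mapI) simp_all
  qed (simp add: \<psi>t from_function_tensor)
  show ?thesis
    by (rule bij_betw_byWitness[where f' = \<psi>])
      (auto simp: left right from_function_closed linear_map_closed[OF \<psi>])
qed

text \<open>A property of an element picked by \<open>SOME\<close> holds once some witness has it;
  so a product with the prescribed values must be exhibited.\<close>

lemma skew_mult_spec:
  "bilinear_map k T T T (skew_mult k G A \<alpha>) \<and>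
    (\<forall>a\<in>carrier A. \<forall>b\<in>carrier A. \<forall>t\<in>carrier G. \<forall>s\<in>carrier G.
      skew_mult k G A \<alpha> (skew_tensor k G A a t) (skew_tensor k G A b s) =
        skew_tensor k G A (a \<otimes>\<^bsub>A\<^esub> \<alpha> t b) (t \<otimes>\<^bsub>G\<^esub> s))" (is "?P (skew_mult k G A \<alpha>)")
proof -
  let ?\<psi> = "inv_into (carrier S) from_function"
  \<comment> \<open>The witness is convolution carried along the bijection; its values on generators
    are \<open>skew_single_mult\<close>.\<close>
  let ?\<mu> = "\<lambda>x y. from_function (?\<psi> x \<otimes>\<^bsub>S\<^esub> ?\<psi> y)"
  note bij = from_function_bij_betw
  have \<psi>f: "?\<psi> (from_function f) = f" if "f \<in> carrier S" for f
    using bij that by (rule bij_betw_inv_into_left)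
  have T: "carrier T = from_function ` carrier S"
    using bij by (simp add: bij_betw_def)
  have \<psi>: "linear_map k T S ?\<psi>"
    by (rule linear_mapI)
      (auto simp: T \<psi>f simp flip: linear_map_add[OF from_function_linear] linear_map_smult[OF from_function_linear])
  have "bilinear_map k T T T ?\<mu>"
    unfolding bilinear_map_def
  proof (intro conjI ballI)
    fix x assume x: "x \<in> carrier T"
    then have "?\<psi> x \<in> carrier S"
      by (rule linear_map_closed[OF \<psi>])
    then show "linear_map k T T (?\<mu> x)" "linear_map k T T (\<lambda>y. ?\<mu> y x)"
      by (auto intro!: linear_map_comp[OF _ from_function_linear] linear_map_comp[OF \<psi>]
          bilinear_map_left[OF S_mult_bilinear] bilinear_map_right[OF S_mult_bilinear])
  qed
  moreover have "?\<mu> (skew_tensor k G A a t) (skew_tensor k G A b s) =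
      skew_tensor k G A (a \<otimes>\<^bsub>A\<^esub> \<alpha> t b) (t \<otimes>\<^bsub>G\<^esub> s)"
    if "a \<in> carrier A" "b \<in> carrier A" "t \<in> carrier G" "s \<in> carrier G" for a b t s
    using that by (simp add: \<psi>f skew_single_closed skew_single_mult flip: from_function_single)
  ultimately have "?P ?\<mu>"
    by blast
  then have P: "?P (SOME \<mu>. ?P \<mu>)"
    by (rule someI[where P = ?P])
  have eq: "skew_mult k G A \<alpha> = (SOME \<mu>. ?P \<mu>)"
    by (simp only: skew_mult_def Let_def)
  show ?thesis
    unfolding eq by (rule P)
qed

text \<open>The chosen product is known only through \<open>skew_mult_spec\<close>. Both sides are
  bilinear in \<open>f\<close> and \<open>g\<close> and agree on one-point functions, so they agree
  everywhere; the extension is made one argument at a time, first in \<open>g\<close>, then in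
  \<open>f\<close>.\<close>

lemma from_function_mult:
  assumes fg: "f \<in> carrier S" "g \<in> carrier S"
  shows "skew_mult k G A \<alpha> (from_function f) (from_function g) = from_function (f \<otimes>\<^bsub>S\<^esub> g)"
proof -
  have b: "bilinear_map k T T T (skew_mult k G A \<alpha>)"
    using skew_mult_spec by blast
  have single: "skew_mult k G A \<alpha> (skew_tensor k G A a t) (from_function g) =
      from_function (skew_single G A t a \<otimes>\<^bsub>S\<^esub> g)"
    if ta: "t \<in> carrier G" "a \<in> carrier A" for t a
  proof (rule linear_map_eq_on_singles[OF _ _ T_abelian_group fg(2)])
    show "linear_map k S T (\<lambda>g. skew_mult k G A \<alpha> (skew_tensor k G A a t) (from_function g))"
      using ta by (intro linear_map_comp[OF from_function_linear] bilinear_map_right[OF b] skew_tensor_closed)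
    show "linear_map k S T (\<lambda>g. from_function (skew_single G A t a \<otimes>\<^bsub>S\<^esub> g))"
      using ta by (intro linear_map_comp[OF _ from_function_linear] bilinear_map_right[OF S_mult_bilinear]
          skew_single_closed)
  qed (use skew_mult_spec ta in \<open>simp add: from_function_single skew_single_mult\<close>)
  show ?thesis
  proof (rule linear_map_eq_on_singles[OF _ _ T_abelian_group fg(1)])
    show "linear_map k S T (\<lambda>f. skew_mult k G A \<alpha> (from_function f) (from_function g))"
      using fg by (intro linear_map_comp[OF from_function_linear] bilinear_map_left[OF b] from_function_closed)
    show "linear_map k S T (\<lambda>f. from_function (f \<otimes>\<^bsub>S\<^esub> g))"
      using fg by (intro linear_map_comp[OF _ from_function_linear] bilinear_map_left[OF S_mult_bilinear])
  qed (simp add: from_function_single single)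
qed

theorem skew_group_algebra_iso:
  shows "associative_algebra k (skew_group_algebra k G A \<alpha>)"
    and "from_function \<in> algebra_iso k S (skew_group_algebra k G A \<alpha>)"
proof -
  let ?B = "skew_group_algebra k G A \<alpha>"
  have "bij_betw from_function (carrier S) (carrier ?B)"
    using from_function_bij_betw by (simp add: skew_group_algebra_def)
  moreover have "\<zero>\<^bsub>?B\<^esub> = from_function \<zero>\<^bsub>S\<^esub>"
    using linear_map_zero[OF from_function_linear S.M.abelian_group_axioms T_abelian_group]
    by (simp add: skew_group_algebra_def)
  moreover have "\<one>\<^bsub>?B\<^esub> = from_function \<one>\<^bsub>S\<^esub>"
    by (simp add: skew_group_algebra_def one_skew_function_algebra from_function_single)
  ultimately show "associative_algebra k ?B" "from_function \<in> algebra_iso k S ?B"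
    by (intro associative_algebra_transport[OF S_associative];
        simp add: skew_group_algebra_def from_function_mult linear_map_add[OF from_function_linear]
          linear_map_smult[OF from_function_linear])+
qed

end

section \<open>The algebra of the skew category\<close>

lemma skew_category_simps [simp]:
  "Ob (skew_category G C) = Ob C"
  "Mor (skew_category G C) y x = direct_sum (carrier G) (\<lambda>s. Mor C y (act_ob C s x))"
  "Idt (skew_category G C) x = (\<lambda>s\<in>carrier G. if s = \<one>\<^bsub>G\<^esub> then Idt C x else \<zero>\<^bsub>Mor C x (act_ob C s x)\<^esub>)"
  by (simp_all add: skew_category_def)

definition skew_entries ::
  "('g, 'h) monoid_scheme \<Rightarrow> ('o, 'k, 'm, 'g, 'c) gcat_scheme \<Rightarrow> ('g \<Rightarrow> 'o \<times> 'o \<Rightarrow> 'm) \<Rightarrow> 'o \<times> 'o \<Rightarrow> 'g \<Rightarrow> 'm"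
  where "skew_entries G C f = (\<lambda>(y, x)\<in>Ob C \<times> Ob C. \<lambda>s\<in>carrier G. f s (y, act_ob C s x))"

context G_category
begin

lemma Mor_skew_module:
  "\<lbrakk>x \<in> Ob C; y \<in> Ob C\<rbrakk> \<Longrightarrow> module k (Mor (skew_category G C) y x)"
  by (auto intro!: module_direct_sum is_cring Mor_module)

text \<open>The defining sum runs over pairs \<open>(t, s)\<close> of nonzero components with
  \<open>t s = u\<close>. For finite \<open>G\<close> the pairs with a zero component may be put
  back, as their composites vanish, and the remaining pairs are parametrized by \<open>t\<close>
  alone, giving the shape of a convolution.\<close>

lemma Cmp_skew_apply:
  assumes fin: "finite (carrier G)" and ob: "x \<in> Ob C" "y \<in> Ob C" "z \<in> Ob C" and u: "u \<in> carrier G"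
    and g: "\<And>t. t \<in> carrier G \<Longrightarrow> g t \<in> carrier (Mor C z (act_ob C t y))"
    and f: "\<And>s. s \<in> carrier G \<Longrightarrow> f s \<in> carrier (Mor C y (act_ob C s x))"
  shows "Cmp (skew_category G C) z y x g f u =
    (\<Oplus>\<^bsub>Mor C z (act_ob C u x)\<^esub>t\<in>carrier G.
      Cmp C z (act_ob C t y) (act_ob C u x) (g t)
        (act_mor C t y (act_ob C (inv\<^bsub>G\<^esub> t \<otimes>\<^bsub>G\<^esub> u) x) (f (inv\<^bsub>G\<^esub> t \<otimes>\<^bsub>G\<^esub> u))))"
proof -
  interpret G: group G by (rule G_is_group)
  interpret M: abelian_group "Mor C z (act_ob C u x)"
    using ob u by (intro Mor_abelian_group) auto
  let ?c = "\<lambda>(t, s). Cmp C z (act_ob C t y) (act_ob C u x) (g t) (act_mor C t y (act_ob C s x) (f s))"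
  let ?D = "{(t, s). t \<in> carrier G \<and> s \<in> carrier G \<and> t \<otimes>\<^bsub>G\<^esub> s = u}"
  let ?D' = "{(t, s). t \<in> carrier G \<and> s \<in> carrier G \<and> t \<otimes>\<^bsub>G\<^esub> s = u \<and>
    g t \<noteq> \<zero>\<^bsub>Mor C z (act_ob C t y)\<^esub> \<and> f s \<noteq> \<zero>\<^bsub>Mor C y (act_ob C s x)\<^esub>}"
  \<comment> \<open>A component at \<open>s\<close> translated by \<open>t\<close> starts at
    \<open>t (s x)\<close>. Identifying this object with \<open>u x\<close> puts all summands into
    one morphism module.\<close>
  have ux: "act_ob C u x = act_ob C t (act_ob C s x)" if "(t, s) \<in> ?D" for t s
    using that ob by (auto simp: composition_rule)
  have act: "act_mor C t y (act_ob C s x) (f s) \<in> carrier (Mor C (act_ob C t y) (act_ob C u x))"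
    if "(t, s) \<in> ?D" for t s
    using that ob f unfolding ux[OF that] by (intro act_mor_closed) auto
  have cl: "?c \<in> ?D \<rightarrow> carrier (Mor C z (act_ob C u x))"
    using act ob u g by (auto intro!: Cmp_closed)
  have zero: "?c p = \<zero>\<^bsub>Mor C z (act_ob C u x)\<^esub>" if p: "p \<in> ?D - ?D'" for p
  proof -
    obtain t s where ts: "p = (t, s)" "(t, s) \<in> ?D" using p by auto
    then have G: "t \<in> carrier G" "s \<in> carrier G" by auto
    consider "g t = \<zero>\<^bsub>Mor C z (act_ob C t y)\<^esub>" | "f s = \<zero>\<^bsub>Mor C y (act_ob C s x)\<^esub>"
      using p ts by auto
    then show ?thesis
    proof cases
      case 1
      then show ?thesis
        using ob u G act[OF ts(2)] by (simp add: ts(1) Cmp_zero)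
    next
      case 2
      have "act_mor C t y (act_ob C s x) (f s) = \<zero>\<^bsub>Mor C (act_ob C t y) (act_ob C u x)\<^esub>"
        unfolding 2 ux[OF ts(2)]
        using ob G by (intro linear_map_zero[OF act_mor_linear] Mor_abelian_group) auto
      then show ?thesis
        using ob u G g by (simp add: ts(1) Cmp_zero)
    qed
  qed
  have bij: "bij_betw (\<lambda>t. (t, inv\<^bsub>G\<^esub> t \<otimes>\<^bsub>G\<^esub> u)) (carrier G) ?D"
    by (rule bij_betw_byWitness[where f' = fst]) (use u in \<open>auto simp flip: G.m_assoc\<close>)
  have "Cmp (skew_category G C) z y x g f u = finsum (Mor C z (act_ob C u x)) ?c ?D'"
    using u by (simp add: skew_category_def)
  also have "\<dots> = finsum (Mor C z (act_ob C u x)) ?c ?D"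
    by (rule M.add.finprod_mono_neutral_cong_left[OF _ _ zero _ cl])
      (auto intro: finite_subset[of _ "carrier G \<times> carrier G"] fin)
  also have "\<dots> = (\<Oplus>\<^bsub>Mor C z (act_ob C u x)\<^esub>t\<in>carrier G. ?c (t, inv\<^bsub>G\<^esub> t \<otimes>\<^bsub>G\<^esub> u))"
    by (rule M.finsum_bij_betw[OF bij cl])
  finally show ?thesis by simp
qed

lemma Cmp_skew_closed:
  assumes fin: "finite (carrier G)" and ob: "x \<in> Ob C" "y \<in> Ob C" "z \<in> Ob C"
    and g: "\<And>t. t \<in> carrier G \<Longrightarrow> g t \<in> carrier (Mor C z (act_ob C t y))"
    and f: "\<And>s. s \<in> carrier G \<Longrightarrow> f s \<in> carrier (Mor C y (act_ob C s x))"
  shows "Cmp (skew_category G C) z y x g f \<in> carrier (Mor (skew_category G C) z x)"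
  unfolding skew_category_simps
proof (rule direct_sum_memI[OF _ _ fin])
  interpret G: group G by (rule G_is_group)
  show "Cmp (skew_category G C) z y x g f \<in> extensional (carrier G)"
    by (simp add: skew_category_def)
  fix u assume u: "u \<in> carrier G"
  interpret M: abelian_group "Mor C z (act_ob C u x)"
    using ob u by (intro Mor_abelian_group) auto
  have "act_mor C t y (act_ob C (inv\<^bsub>G\<^esub> t \<otimes>\<^bsub>G\<^esub> u) x) (f (inv\<^bsub>G\<^esub> t \<otimes>\<^bsub>G\<^esub> u)) \<in>
      carrier (Mor C (act_ob C t y) (act_ob C u x))" if t: "t \<in> carrier G" for t
    using act_mor_closed[of t "act_ob C (inv\<^bsub>G\<^esub> t \<otimes>\<^bsub>G\<^esub> u) x" y "f (inv\<^bsub>G\<^esub> t \<otimes>\<^bsub>G\<^esub> u)"]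
      f[of "inv\<^bsub>G\<^esub> t \<otimes>\<^bsub>G\<^esub> u"] t u ob
    by (simp add: composition_rule)
  then show "Cmp (skew_category G C) z y x g f u \<in> carrier (Mor C z (act_ob C u x))"
    using g ob u
    by (subst Cmp_skew_apply[OF fin ob u]) (auto intro!: M.finsum_closed Cmp_closed f)
qed

lemma skew_category_algebra_closed:
  assumes "F \<in> carrier (category_algebra (skew_category G C))" "y \<in> Ob C" "x \<in> Ob C"
  shows "F (y, x) \<in> extensional (carrier G)"
    and "s \<in> carrier G \<Longrightarrow> F (y, x) s \<in> carrier (Mor C y (act_ob C s x))"
  using category_algebra_closed[OF assms(1), of y x] assms(2,3) direct_sum_closed[of "F (y, x)"]
  by (fastforce simp: direct_sum_def PiE_def)+

text \<open>Only extensionality at both levels is asked for, so this form applies to sums and scalar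
  multiples before they are known to lie in the carrier.\<close>

lemma skew_category_algebra_ext:
  assumes "F \<in> extensional (Ob C \<times> Ob C)" "F' \<in> extensional (Ob C \<times> Ob C)"
    and "\<And>y x. \<lbrakk>y \<in> Ob C; x \<in> Ob C\<rbrakk> \<Longrightarrow> F (y, x) \<in> extensional (carrier G)"
    and "\<And>y x. \<lbrakk>y \<in> Ob C; x \<in> Ob C\<rbrakk> \<Longrightarrow> F' (y, x) \<in> extensional (carrier G)"
    and "\<And>y x s. \<lbrakk>y \<in> Ob C; x \<in> Ob C; s \<in> carrier G\<rbrakk> \<Longrightarrow> F (y, x) s = F' (y, x) s"
  shows "F = F'"
  using assms by (intro extensionalityI[OF assms(1,2)]) (auto intro!: extensionalityI[of _ "carrier G"])

lemma skew_entries_extensional: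
  "skew_entries G C f \<in> extensional (Ob C \<times> Ob C)"
  "\<lbrakk>y \<in> Ob C; x \<in> Ob C\<rbrakk> \<Longrightarrow> skew_entries G C f (y, x) \<in> extensional (carrier G)"
  by (simp_all add: skew_entries_def)

lemma skew_entries_apply:
  "\<lbrakk>y \<in> Ob C; x \<in> Ob C; s \<in> carrier G\<rbrakk> \<Longrightarrow> skew_entries G C f (y, x) s = f s (y, act_ob C s x)"
  by (simp add: skew_entries_def)

theorem skew_category_algebra_iso:
  fixes \<alpha> defines "\<alpha> \<equiv> category_algebra_action G C"
  assumes finG: "finite (carrier G)" and finOb: "finite (Ob C)"
  shows "associative_algebra k (category_algebra (skew_category G C))"
    and "skew_entries G C \<in>
      algebra_iso k (skew_function_algebra G (category_algebra C) \<alpha>) (category_algebra (skew_category G C))"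
proof -
  let ?A = "category_algebra C" and ?E = "category_algebra (skew_category G C)"
  let ?h = "skew_entries G C"
  interpret finite_group_acting_on_algebra k G ?A \<alpha>
    using acts_by_algebra_automorphisms_category_algebra[OF finOb] finG
    by (intro finite_group_acting_on_algebra.intro) (simp_all add: \<alpha>_def)
  note cl = skew_function_algebra_closed and ap = skew_function_algebra_apply
  have mor: "f s (y, x) \<in> carrier (Mor C y x)"
    if "f \<in> carrier S" "s \<in> carrier G" "y \<in> Ob C" "x \<in> Ob C" for f s y x
    using category_algebra_closed[OF cl[OF that(1,2)] that(3,4)] .
  have hc: "?h f \<in> carrier ?E" if "f \<in> carrier S" for f
    using that finOb
    by (intro category_algebra_memI)
      (auto simp: skew_entries_extensional skew_entries_apply mor intro!: direct_sum_memI finG)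
  \<comment> \<open>The inverse solves \<open>w = s x\<close> for \<open>x\<close>.\<close>
  let ?h' = "\<lambda>F. \<lambda>s\<in>carrier G. \<lambda>(y, w)\<in>Ob C \<times> Ob C. F (y, act_ob C (inv\<^bsub>G\<^esub> s) w) s"
  have h'c: "?h' F \<in> carrier S" if F: "F \<in> carrier ?E" for F
  proof (intro skew_function_algebra_memI finG)
    fix s assume s: "s \<in> carrier G"
    have "F (y, act_ob C (inv\<^bsub>G\<^esub> s) w) s \<in> carrier (Mor C y w)" if "y \<in> Ob C" "w \<in> Ob C" for y w
      using skew_category_algebra_closed(2)[OF F, of y "act_ob C (inv\<^bsub>G\<^esub> s) w" s] s that by simp
    with s show "?h' F s \<in> carrier ?A"
      by (auto intro!: category_algebra_memI finOb)
  qed simp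
  have bij: "bij_betw ?h (carrier S) (carrier ?E)"
  proof (rule bij_betw_byWitness[where f' = ?h'])
    show "\<forall>f\<in>carrier S. ?h' (?h f) = f"
    proof
      fix f assume f: "f \<in> carrier S"
      show "?h' (?h f) = f"
      proof (rule skew_function_algebra_ext[OF h'c[OF hc[OF f]] f])
        fix s assume s: "s \<in> carrier G"
        show "?h' (?h f) s = f s"
          using s h'c[OF hc[OF f], THEN cl, OF s] cl[OF f s]
          by (intro category_algebra_ext[of _ C]) (auto simp: skew_entries_apply)
      qed
    qed
    show "\<forall>F\<in>carrier ?E. ?h (?h' F) = F"
    proof
      fix F assume F: "F \<in> carrier ?E"
      then have "F \<in> extensional (Ob C \<times> Ob C)"
        by (simp add: carrier_category_algebra direct_sum_def PiE_def)
      with F show "?h (?h' F) = F"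
        by (intro skew_category_algebra_ext)
          (auto simp: skew_entries_extensional skew_entries_apply skew_category_algebra_closed)
    qed
  qed (use hc h'c in auto)
  have mult: "?h f \<otimes>\<^bsub>?E\<^esub> ?h g = ?h (f \<otimes>\<^bsub>S\<^esub> g)" if f: "f \<in> carrier S" and g: "g \<in> carrier S" for f g
  proof (rule skew_category_algebra_ext)
    note Ecl = skew_category_algebra_closed(2)[OF hc]
    fix z x assume zx: "z \<in> Ob C" "x \<in> Ob C"
    let ?M = "Mor (skew_category G C) z x"
    interpret M: module k ?M
      by (rule Mor_skew_module[OF zx(2,1)])
    let ?c = "\<lambda>y. Cmp (skew_category G C) z y x (?h f (z, y)) (?h g (y, x))"
    have cc: "?c \<in> Ob C \<rightarrow> carrier ?M"
      using zx by (auto simp del: skew_category_simps intro!: Cmp_skew_closed finG Ecl f g)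
    have entry: "(?h f \<otimes>\<^bsub>?E\<^esub> ?h g) (z, x) = finsum ?M ?c (Ob C)"
      using zx by (simp add: category_algebra_apply)
    have "finsum ?M ?c (Ob C) \<in> carrier ?M"
      by (rule M.M.finsum_closed[OF cc])
    then show "(?h f \<otimes>\<^bsub>?E\<^esub> ?h g) (z, x) \<in> extensional (carrier G)"
      unfolding entry by (simp add: direct_sum_def PiE_def)
    fix u assume u: "u \<in> carrier G"
    let ?N = "Mor C z (act_ob C u x)"
    let ?v = "\<lambda>t. inv\<^bsub>G\<^esub> t \<otimes>\<^bsub>G\<^esub> u"
    interpret N: abelian_group ?N
      using zx u by (intro Mor_abelian_group) auto
    have ux: "act_ob C t (act_ob C (?v t) x) = act_ob C u x" if "t \<in> carrier G" for t
      using that u zx by (simp add: composition_rule)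
    \<comment> \<open>The translate by \<open>t\<close> that occurs in skew composition is an entry
      of the \<open>\<alpha> t\<close>-image that occurs in convolution; its position is
      \<open>(t y, u x)\<close> because \<open>t\<close> takes \<open>(inv t u) x\<close> to
      \<open>u x\<close>.\<close>
    have act: "act_mor C t y (act_ob C (?v t) x) (g (?v t) (y, act_ob C (?v t) x)) =
        \<alpha> t (g (?v t)) (act_ob C t y, act_ob C u x)"
      if "t \<in> carrier G" "y \<in> Ob C" for t y
      using category_algebra_action_apply[of t "g (?v t)" y "act_ob C (?v t) x"] that u zx cl[OF g] ux
      by (simp add: \<alpha>_def)
    have gc: "\<alpha> t (g (?v t)) (y, act_ob C u x) \<in> carrier (Mor C y (act_ob C u x))"
      if "t \<in> carrier G" "y \<in> Ob C" for t y
      using that u zx cl[OF g] by (intro category_algebra_closed) auto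
    have "(?h f \<otimes>\<^bsub>?E\<^esub> ?h g) (z, x) u = (\<Oplus>\<^bsub>?N\<^esub>y\<in>Ob C. ?c y u)"
      unfolding entry skew_category_simps
      using zx u cc
      by (intro finsum_direct_sum_apply[where k = k and M = "\<lambda>s. Mor C z (act_ob C s x)"] is_cring Mor_module) auto
    also have "\<dots> = (\<Oplus>\<^bsub>?N\<^esub>y\<in>Ob C. \<Oplus>\<^bsub>?N\<^esub>t\<in>carrier G.
        Cmp C z (act_ob C t y) (act_ob C u x) (f t (z, act_ob C t y))
          (\<alpha> t (g (?v t)) (act_ob C t y, act_ob C u x)))"
    proof (rule N.finsum_cong'[OF refl])
      fix y assume y: "y \<in> Ob C"
      have "?c y u = (\<Oplus>\<^bsub>?N\<^esub>t\<in>carrier G. Cmp C z (act_ob C t y) (act_ob C u x) (?h f (z, y) t)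
          (act_mor C t y (act_ob C (?v t) x) (?h g (y, x) (?v t))))"
        using zx y u by (intro Cmp_skew_apply finG Ecl f g)
      also have "\<dots> = (\<Oplus>\<^bsub>?N\<^esub>t\<in>carrier G. Cmp C z (act_ob C t y) (act_ob C u x) (f t (z, act_ob C t y))
          (\<alpha> t (g (?v t)) (act_ob C t y, act_ob C u x)))"
        using zx y u
        by (intro N.finsum_cong') (auto simp: skew_entries_apply act Cmp_closed mor[OF f] gc)
      finally show "?c y u = \<dots>" .
    qed (use zx u in \<open>auto simp: Cmp_closed mor[OF f] gc intro!: N.finsum_closed\<close>)
    \<comment> \<open>The sum over the group is moved outside because the substitution of
      \<open>t y\<close> by \<open>y\<close>, which yields a matrix product in \<open>a(C)\<close>,
      depends on \<open>t\<close>.\<close>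
    also have "\<dots> = (\<Oplus>\<^bsub>?N\<^esub>t\<in>carrier G. \<Oplus>\<^bsub>?N\<^esub>y\<in>Ob C.
        Cmp C z (act_ob C t y) (act_ob C u x) (f t (z, act_ob C t y))
          (\<alpha> t (g (?v t)) (act_ob C t y, act_ob C u x)))"
      using zx u by (intro N.finsum_swap finG finOb) (simp add: Cmp_closed mor[OF f] gc)
    also have "\<dots> = (\<Oplus>\<^bsub>?N\<^esub>t\<in>carrier G. (f t \<otimes>\<^bsub>?A\<^esub> \<alpha> t (g (?v t))) (z, act_ob C u x))"
    proof (rule N.finsum_cong'[OF refl])
      fix t assume t: "t \<in> carrier G"
      show "(\<Oplus>\<^bsub>?N\<^esub>y\<in>Ob C. Cmp C z (act_ob C t y) (act_ob C u x) (f t (z, act_ob C t y))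
          (\<alpha> t (g (?v t)) (act_ob C t y, act_ob C u x))) = (f t \<otimes>\<^bsub>?A\<^esub> \<alpha> t (g (?v t))) (z, act_ob C u x)"
        unfolding category_algebra_apply(1)[OF zx(1) act_ob_closed[OF u zx(2)]]
        using t u zx
        by (intro N.finsum_bij_betw[OF act_ob_bij_betw, symmetric]) (auto simp: Cmp_closed mor[OF f] gc)
    next
      show "(\<lambda>t. (f t \<otimes>\<^bsub>?A\<^esub> \<alpha> t (g (?v t))) (z, act_ob C u x)) \<in> carrier G \<rightarrow> carrier ?N"
        using zx u cl[OF f] cl[OF g] by (auto intro!: category_algebra_closed)
    qed
    \<comment> \<open>Taking the entry at \<open>(z, u x)\<close> is linear, so the sum of entries
      is the entry of the convolution sum in \<open>a(C)\<close>.\<close>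
    also have "\<dots> = (f \<otimes>\<^bsub>S\<^esub> g) u (z, act_ob C u x)"
      unfolding ap(1)[OF u]
      using zx u cl[OF f] cl[OF g]
      by (intro linear_map_finsum[where h = "\<lambda>a. a (z, act_ob C u x)" and k = k, symmetric] linear_mapI
          A.M.abelian_group_axioms N.abelian_group_axioms)
        (auto simp: category_algebra_apply category_algebra_closed)
    also have "\<dots> = ?h (f \<otimes>\<^bsub>S\<^esub> g) (z, x) u"
      using zx u by (simp add: skew_entries_apply)
    finally show "(?h f \<otimes>\<^bsub>?E\<^esub> ?h g) (z, x) u = ?h (f \<otimes>\<^bsub>S\<^esub> g) (z, x) u" .
  qed (use category_algebra_extensional(1)[where C = "skew_category G C"] in
      \<open>auto simp: skew_entries_extensional\<close>)
  have add: "?h f \<oplus>\<^bsub>?E\<^esub> ?h g = ?h (f \<oplus>\<^bsub>S\<^esub> g)" for f g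
    using category_algebra_extensional(3)[where C = "skew_category G C"]
    by (intro skew_category_algebra_ext skew_entries_extensional)
      (auto simp: category_algebra_apply direct_sum_apply skew_entries_apply ap direct_sum_def)
  have smult: "a \<odot>\<^bsub>?E\<^esub> ?h f = ?h (a \<odot>\<^bsub>S\<^esub> f)" for a f
    using category_algebra_extensional(5)[where C = "skew_category G C"]
    by (intro skew_category_algebra_ext skew_entries_extensional)
      (auto simp: category_algebra_apply direct_sum_apply skew_entries_apply ap direct_sum_def)
  have zero: "\<zero>\<^bsub>?E\<^esub> = ?h \<zero>\<^bsub>S\<^esub>"
    using category_algebra_extensional(4)[where C = "skew_category G C"]
    by (intro skew_category_algebra_ext skew_entries_extensional)
      (auto simp: category_algebra_apply direct_sum_apply skew_entries_apply ap direct_sum_def)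
  \<comment> \<open>On both sides the component at \<open>s\<close> vanishes unless \<open>s\<close>
    is neutral, and then \<open>(y, s x)\<close> is \<open>(y, x)\<close>, so the identities sit on
    the same diagonal.\<close>
  have one: "\<one>\<^bsub>?E\<^esub> = ?h \<one>\<^bsub>S\<^esub>"
    using category_algebra_extensional(2)[where C = "skew_category G C"]
    by (intro skew_category_algebra_ext skew_entries_extensional)
      (auto simp: category_algebra_apply direct_sum_apply skew_entries_apply ap direct_sum_def)
  show "associative_algebra k ?E" "?h \<in> algebra_iso k S ?E"
    by (rule associative_algebra_transport[OF S_associative bij]; simp only: add smult mult zero one)+
qed

end

theorem proposition2p4:
  fixes k :: "('k, 'r) ring_scheme"
    and G :: "('g, 'h) monoid_scheme"
    and C :: "('o, 'k, 'm, 'g, 'c) gcat_scheme"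
  assumes "cring k"
    and "group G" and "finite (carrier G)"
    and "G_category k G C" and "finite (Ob C)"
  shows "acts_by_algebra_automorphisms k G (category_algebra C) (category_algebra_action G C) \<and>
    algebra_isomorphic k (category_algebra (skew_category G C))
      (skew_group_algebra k G (category_algebra C) (category_algebra_action G C))"
proof
  interpret G_category k G C by fact
  show acts: "acts_by_algebra_automorphisms k G (category_algebra C) (category_algebra_action G C)"
    using assms(5) by (rule acts_by_algebra_automorphisms_category_algebra)
  interpret finite_group_acting_on_algebra k G "category_algebra C" "category_algebra_action G C"
    using acts assms(3) by (rule finite_group_acting_on_algebra.intro)
  note E = skew_category_algebra_iso[OF assms(3,5)]
  \<comment> \<open>The isomorphism first reads an element of \<open>a(C[G])\<close> as a function
    on \<open>G\<close> with values in \<open>a(C)\<close>, then turns that function into a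
    tensor.\<close>
  have "from_function \<circ> inv_into (carrier S) (skew_entries G C) \<in>
      algebra_iso k (category_algebra (skew_category G C))
        (skew_group_algebra k G (category_algebra C) (category_algebra_action G C))"
    using algebra_iso_sym[OF S_associative E(2)] skew_group_algebra_iso(2) by (rule algebra_iso_trans)
  then show "algebra_isomorphic k (category_algebra (skew_category G C))
      (skew_group_algebra k G (category_algebra C) (category_algebra_action G C))"
    using E(1) skew_group_algebra_iso(1) by (auto simp: algebra_isomorphic_def)
qed

end
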